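(* Let $t\geq 2$ be an integer and let $\alpha_t$ be the largest real root of $x^t=x^{t-1}+x^{t-2}+\cdots+x+1$. There is an algorithm that, given a $t$-program $P$, computes all stable models of $P$ in time $O(m\,\alpha_t^{\,n})$, where $n$ is the number of atoms and $m$ is the size of $P$.
   Context: A clause is $p\leftarrow B$ or $\leftarrow B$ (a constraint), where $p$ is an atom and $B$ is a finite set of literals (atoms $a$ or negated atoms $\mathrm{not}(a)$). A (propositional) logic program is a finite set of clauses; it is a $t$-program if every clause has at most $t$ literals, counting the head. The size $m$ of a program is the size of its standard representation (total number of occurrences of atoms). $M\subseteq\mathit{At}(P)$ (the set of atoms of $P$) is a stable model of $P$ if $M$ satisfies all constraints of $P$ and $M$ is the least model of the Gelfond–Lifschitz reduct $P^M$, obtained by deleting every non-constraint clause having some $\mathrm{not}(a)$ with $a\in M$ in its body and deleting all negated literals from the remaining non-constraint clauses. *)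

theory Defs
  imports Complex_Main "HOL-Computational_Algebra.Polynomial"
begin

section \<open>Logic programs and stable models\<close>

datatype 'a literal = Pos (atom_of: 'a) | Neg (atom_of: 'a)

text \<open>A constraint is a clause whose head is \<^term>\<open>None\<close>.\<close>

datatype 'a clause = Clause (head: "'a option") (body: "'a literal set")

definition clause_size :: "'a clause \<Rightarrow> nat" where
  "clause_size r = (case head r of None \<Rightarrow> 0 | Some p \<Rightarrow> 1) + card (body r)"

definition logic_program :: "'a clause set \<Rightarrow> bool" where
  "logic_program P \<longleftrightarrow> finite P \<and> (\<forall>r\<in>P. finite (body r))"

definition t_program :: "nat \<Rightarrow> 'a clause set \<Rightarrow> bool" where
  "t_program t P \<longleftrightarrow> logic_program P \<and> (\<forall>r\<in>P. clause_size r \<le> t)"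

definition atoms :: "'a clause set \<Rightarrow> 'a set" where
  "atoms P = (\<Union>r\<in>P. set_option (head r) \<union> atom_of ` body r)"

definition program_size :: "'a clause set \<Rightarrow> nat" where
  "program_size P = (\<Sum>r\<in>P. clause_size r)"

fun sat_literal :: "'a set \<Rightarrow> 'a literal \<Rightarrow> bool" where
  "sat_literal M (Pos a) \<longleftrightarrow> a \<in> M"
| "sat_literal M (Neg a) \<longleftrightarrow> a \<notin> M"

definition sat_clause :: "'a set \<Rightarrow> 'a clause \<Rightarrow> bool" where
  "sat_clause M r \<longleftrightarrow> (\<forall>l\<in>body r. sat_literal M l) \<longrightarrow> (\<exists>p\<in>set_option (head r). p \<in> M)"

definition is_model :: "'a set \<Rightarrow> 'a clause set \<Rightarrow> bool" where
  "is_model M P \<longleftrightarrow> (\<forall>r\<in>P. sat_clause M r)"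

definition is_least_model :: "'a set \<Rightarrow> 'a clause set \<Rightarrow> bool" where
  "is_least_model M P \<longleftrightarrow> is_model M P \<and> (\<forall>N. is_model N P \<longrightarrow> M \<subseteq> N)"

definition constraints :: "'a clause set \<Rightarrow> 'a clause set" where
  "constraints P = {r \<in> P. head r = None}"

text \<open>The reduct is a Horn program: it is formed from the non-constraint clauses only, and
  the constraints are tested separately in the definition of a stable model.\<close>

definition reduct :: "'a clause set \<Rightarrow> 'a set \<Rightarrow> 'a clause set" where
  "reduct P M =
     {Clause (head r) {l \<in> body r. \<exists>a. l = Pos a} | r.
        r \<in> P \<and> head r \<noteq> None \<and> \<not> (\<exists>a\<in>M. Neg a \<in> body r)}"

definition stable_model :: "'a clause set \<Rightarrow> 'a set \<Rightarrow> bool" where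
  "stable_model P M \<longleftrightarrow>
     M \<subseteq> atoms P \<and> is_model M (constraints P) \<and> is_least_model M (reduct P M)"


section \<open>The growth rate\<close>

definition alpha :: "nat \<Rightarrow> real" where
  "alpha t = Max {x. x ^ t = (\<Sum>i<t. x ^ i)}"

lemma alpha_roots_finite: "finite {x::real. x ^ t = (\<Sum>i<t. x ^ i)}"
proof -
  let ?p = "monom 1 t - (\<Sum>i<t. monom 1 i) :: real poly"
  have "coeff ?p t = 1"
    by (simp add: coeff_sum)
  then have "?p \<noteq> 0"
    by (metis coeff_0 zero_neq_one)
  then have "finite {x. poly ?p x = 0}"
    by (rule poly_roots_finite)
  then show ?thesis
    by (simp add: poly_sum poly_monom)
qed

lemma alpha_roots_nonempty:
  assumes "t \<ge> 2"
  shows "{x::real. x ^ t = (\<Sum>i<t. x ^ i)} \<noteq> {}"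
proof -
  let ?f = "\<lambda>x::real. x ^ t - (\<Sum>i<t. x ^ i)"
  have "?f 1 \<le> 0" using assms by simp
  moreover have "?f 2 = 1"
    using power_diff_1_eq[of "2::real" t] by simp
  moreover have "continuous_on {1..2} ?f"
    by (intro continuous_intros)
  ultimately obtain x where "?f x = 0"
    using IVT'[of ?f 1 0 2] by auto
  then show ?thesis by auto
qed


section \<open>Random access machines\<close>

text \<open>
  Algorithms are structured programs of a random access machine.  A program refers to finitely
  many integer registers and finitely many unbounded arrays, both named by natural numbers and
  initially zero, and appends its results to an output tape that it cannot read.  Every executed
  instruction and every evaluated test costs one time unit.  The only arithmetic is successor
  and (truncated) predecessor, so unit cost cannot be abused to build large integers quickly.
\<close>

datatype test = Less nat nat | Equal nat nat | Unequal nat nat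

datatype com =
    Skip
  | Const nat nat
  | Copy nat nat
  | Inc nat
  | Dec nat
  | Load nat nat nat   \<comment> \<open>\<open>Load x a i\<close>: \<open>x := a[i]\<close>\<close>
  | Store nat nat nat  \<comment> \<open>\<open>Store a i x\<close>: \<open>a[i] := x\<close>\<close>
  | Emit nat
  | Seq com com
  | Cond test com com
  | While test com

record state =
  reg :: "nat \<Rightarrow> nat"
  arr :: "nat \<Rightarrow> nat \<Rightarrow> nat"
  out :: "nat list"

fun test_holds :: "test \<Rightarrow> state \<Rightarrow> bool" where
  "test_holds (Less x y) s \<longleftrightarrow> reg s x < reg s y"
| "test_holds (Equal x y) s \<longleftrightarrow> reg s x = reg s y"
| "test_holds (Unequal x y) s \<longleftrightarrow> reg s x \<noteq> reg s y"

definition set_reg :: "nat \<Rightarrow> nat \<Rightarrow> state \<Rightarrow> state" where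
  "set_reg x v s = s\<lparr>reg := (reg s)(x := v)\<rparr>"

definition set_arr :: "nat \<Rightarrow> nat \<Rightarrow> nat \<Rightarrow> state \<Rightarrow> state" where
  "set_arr a i v s = s\<lparr>arr := (arr s)(a := (arr s a)(i := v))\<rparr>"

text \<open>\<open>exec c s T s'\<close>: started in \<open>s\<close>, the program \<open>c\<close> halts in \<open>s'\<close> after exactly \<open>T\<close>
  time units.\<close>

inductive exec :: "com \<Rightarrow> state \<Rightarrow> nat \<Rightarrow> state \<Rightarrow> bool" where
  Skip: "exec Skip s 1 s"
| Const: "exec (Const x k) s 1 (set_reg x k s)"
| Copy: "exec (Copy x y) s 1 (set_reg x (reg s y) s)"
| Inc: "exec (Inc x) s 1 (set_reg x (reg s x + 1) s)"
| Dec: "exec (Dec x) s 1 (set_reg x (reg s x - 1) s)"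
| Load: "exec (Load x a i) s 1 (set_reg x (arr s a (reg s i)) s)"
| Store: "exec (Store a i x) s 1 (set_arr a (reg s i) (reg s x) s)"
| Emit: "exec (Emit x) s 1 (s\<lparr>out := out s @ [reg s x]\<rparr>)"
| Seq: "exec c s T s' \<Longrightarrow> exec d s' U s'' \<Longrightarrow> exec (Seq c d) s (T + U) s''"
| CondTrue: "test_holds b s \<Longrightarrow> exec c s T s' \<Longrightarrow> exec (Cond b c d) s (1 + T) s'"
| CondFalse: "\<not> test_holds b s \<Longrightarrow> exec d s T s' \<Longrightarrow> exec (Cond b c d) s (1 + T) s'"
| WhileFalse: "\<not> test_holds b s \<Longrightarrow> exec (While b c) s 1 s"
| WhileTrue: "test_holds b s \<Longrightarrow> exec c s T s' \<Longrightarrow> exec (While b c) s' U s'' \<Longrightarrow>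
    exec (While b c) s (1 + T + U) s''"

inductive_cases exec_elims:
  "exec Skip s T s'" "exec (Const x k) s T s'" "exec (Copy x y) s T s'" "exec (Inc x) s T s'"
  "exec (Dec x) s T s'" "exec (Load x a i) s T s'" "exec (Store a i x) s T s'"
  "exec (Emit x) s T s'" "exec (Seq c d) s T s'" "exec (Cond b c d) s T s'"

lemma exec_deterministic:
  "exec c s T s' \<Longrightarrow> exec c s U s'' \<Longrightarrow> T = U \<and> s' = s''"
proof (induction arbitrary: U s'' rule: exec.induct)
  case (Seq c s T s' d V s3)
  from Seq.prems obtain T1 U1 s1 where "U = T1 + U1" "exec c s T1 s1" "exec d s1 U1 s''"
    by (rule exec_elims(9))
  then show ?case using Seq.IH by blast
next
  case (CondTrue b s c T s' d)
  from CondTrue.prems CondTrue.hyps(1) obtain T1 where "U = 1 + T1" "exec c s T1 s''"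
    by (auto elim: exec_elims(10))
  then show ?case using CondTrue.IH by blast
next
  case (CondFalse b s d T s' c)
  from CondFalse.prems CondFalse.hyps(1) obtain T1 where "U = 1 + T1" "exec d s T1 s''"
    by (auto elim: exec_elims(10))
  then show ?case using CondFalse.IH by blast
next
  case (WhileFalse b s c)
  from WhileFalse.prems WhileFalse.hyps show ?case by cases auto
next
  case (WhileTrue b s c T s' V s3)
  from WhileTrue.prems WhileTrue.hyps(1) obtain T1 U1 s1
    where "U = 1 + T1 + U1" "exec c s T1 s1" "exec (While b c) s1 U1 s''"
    by cases auto
  then show ?case using WhileTrue.IH by blast
qed (erule exec_elims, simp)+


section \<open>Input and output conventions\<close>

text \<open>The standard representation lists the clauses of a program, and the literals of each body,
  in an arbitrary order and without repetition.\<close>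

type_synonym clause_rep = "nat option \<times> nat literal list"

definition clause_of :: "clause_rep \<Rightarrow> nat clause" where
  "clause_of r = Clause (fst r) (set (snd r))"

definition represents :: "clause_rep list \<Rightarrow> nat clause set \<Rightarrow> bool" where
  "represents R P \<longleftrightarrow>
     (\<forall>r\<in>set R. distinct (snd r)) \<and> distinct (map clause_of R) \<and> set (map clause_of R) = P"

text \<open>In memory, each occurrence of an atom takes two cells, a tag followed by the atom, and
  each clause is closed by a zero.\<close>

fun encode_literal :: "nat literal \<Rightarrow> nat list" where
  "encode_literal (Pos a) = [2, a]"
| "encode_literal (Neg a) = [3, a]"

definition encode_clause :: "clause_rep \<Rightarrow> nat list" where
  "encode_clause r =
     (case fst r of None \<Rightarrow> [] | Some p \<Rightarrow> [1, p]) @ concat (map encode_literal (snd r)) @ [0]"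

definition encode :: "clause_rep list \<Rightarrow> nat list" where
  "encode R = concat (map encode_clause R)"

text \<open>The input is placed in array 0 and its length in register 0.\<close>

definition initial_state :: "nat list \<Rightarrow> state" where
  "initial_state xs =
     \<lparr>reg = (\<lambda>_. 0)(0 := length xs),
      arr = (\<lambda>_ _. 0)(0 := (\<lambda>i. if i < length xs then xs ! i else 0)),
      out = []\<rparr>"

text \<open>The output lists each set exactly once: its elements, shifted by one, followed by a zero.\<close>

definition enumerates :: "nat list \<Rightarrow> nat set set \<Rightarrow> bool" where
  "enumerates w \<M> \<longleftrightarrow>
     (\<exists>Ls. (\<forall>L\<in>set Ls. distinct L) \<and> distinct (map set Ls) \<and> set (map set Ls) = \<M> \<and>
           w = concat (map (\<lambda>L. map Suc L @ [0]) Ls))"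

end

theory Submission imports Defs begin

text \<open>
  A stable model is a minimal model of the program, so if a partial assignment satisfies every clause,
  the only stable model extending it makes all unassigned atoms false.  The algorithm backtracks over
  partial assignments, branching on an unassigned atom of the last unsatisfied non-tautological clause.
  One of the two branches satisfies this clause; the other keeps it the last unsatisfied one, with one
  unassigned atom less.  A clause with \<open>j \<le> t\<close> unassigned atoms therefore contributes
  \<open>T(n - 1) + \<dots> + T(n - j)\<close> nodes up to a constant, whence \<open>T(n) = O(\<alpha>\<^sub>t\<^sup>n)\<close>.  Each node costs
  \<open>O(m)\<close>: the assignment is rebuilt from the trail, and at a leaf the least model of the reduct is
  computed by linear-time Horn propagation, counting the underived body atoms of every clause.
\<close>

section \<open>Reasoning about machine programs\<close>

text \<open>Branching on one atom at a time adds inner nodes to those counted by the recurrence, so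
  a refined count for a tree with a known open clause is proved together with the general one.
  Tautologies are set aside because both values of their atom satisfy them: branching there would
  only give \<open>2 * T(n - 1)\<close>. The growth rate fits since dividing the equation of
  \<open>alpha t\<close> by \<open>alpha t ^ t\<close> makes the first \<open>t\<close> inverse
  powers add up to 1. The cost per node must be linear without logarithmic factors. Atoms therefore
  serve directly as array indices, and as they may be arbitrarily large numbers, such arrays are
  cleared only at the atoms that occur. Taking the last unsatisfied clause and its last unassigned
  occurrence suits an upward scan that overwrites what it found before. At a leaf the true atoms
  form a model of the program and hence of its reduct, so the least model of the reduct is contained
  in them and stability is a single inclusion.\<close>

lemma set_reg_simps [simp]:
  "reg (set_reg x v s) = (reg s)(x := v)"
  "arr (set_reg x v s) = arr s"
  "out (set_reg x v s) = out s"
  by (simp_all add: set_reg_def)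

lemma set_arr_simps [simp]:
  "reg (set_arr a i v s) = reg s"
  "arr (set_arr a i v s) = (arr s)(a := (arr s a)(i := v))"
  "out (set_arr a i v s) = out s"
  by (simp_all add: set_arr_def)

definition emit :: "nat \<Rightarrow> state \<Rightarrow> state" where
  "emit v s = s\<lparr>out := out s @ [v]\<rparr>"

lemma emit_simps [simp]:
  "reg (emit v s) = reg s"
  "arr (emit v s) = arr s"
  "out (emit v s) = out s @ [v]"
  by (simp_all add: emit_def)

text \<open>A total-correctness triple with time budget \<open>b\<close>. Since \<open>exec\<close>
  is deterministic, the existential speaks about the only run.\<close>

definition runs :: "com \<Rightarrow> state \<Rightarrow> nat \<Rightarrow> (state \<Rightarrow> bool) \<Rightarrow> bool" where
  "runs c s b Q \<longleftrightarrow> (\<exists>T s'. exec c s T s' \<and> T \<le> b \<and> Q s')"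

lemma runs_mono: "runs c s b Q \<Longrightarrow> b \<le> b' \<Longrightarrow> (\<And>s'. Q s' \<Longrightarrow> Q' s') \<Longrightarrow> runs c s b' Q'"
  unfolding runs_def by (meson le_trans)

lemma runs_Seq:
  assumes "runs c s b P" and "\<And>s'. P s' \<Longrightarrow> runs d s' b' Q" and "b + b' \<le> b''"
  shows "runs (Seq c d) s b'' Q"
proof -
  obtain T s' where 1: "exec c s T s'" "T \<le> b" "P s'" using assms(1) by (auto simp: runs_def)
  obtain U s'' where 2: "exec d s' U s''" "U \<le> b'" "Q s''" using assms(2)[OF 1(3)] by (auto simp: runs_def)
  have "T + U \<le> b''" using 1(2) 2(2) assms(3) by linarith
  then show ?thesis using exec.Seq[OF 1(1) 2(1)] 2(3) unfolding runs_def by blast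
qed

lemma runs_Cond:
  assumes "test_holds b s \<Longrightarrow> runs c s k Q" and "\<not> test_holds b s \<Longrightarrow> runs d s k Q" and "k + 1 \<le> k'"
  shows "runs (Cond b c d) s k' Q"
proof (cases "test_holds b s")
  case True
  then obtain T s' where "exec c s T s'" "T \<le> k" "Q s'" using assms(1) by (auto simp: runs_def)
  then show ?thesis unfolding runs_def using exec.CondTrue[OF True, of c T s' d] assms(3)
    by (intro exI[of _ "1 + T"] exI[of _ s']) auto
next
  case False
  then obtain T s' where "exec d s T s'" "T \<le> k" "Q s'" using assms(2) by (auto simp: runs_def)
  then show ?thesis unfolding runs_def using exec.CondFalse[OF False, of d T s' c] assms(3)
    by (intro exI[of _ "1 + T"] exI[of _ s']) auto
qed

text \<open>The variant is an index of the invariant, not a function of the state: later loops are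
  measured by ghost data (a trail, a set of processed occurrences) that occur only existentially in
  their invariants.\<close>

lemma runs_While_variant:
  assumes step: "\<And>n s. I n s \<Longrightarrow> test_holds b s \<Longrightarrow> runs c s k (\<lambda>s'. \<exists>m<n. I m s')"
    and "I n s" and post: "\<And>n s. I n s \<Longrightarrow> \<not> test_holds b s \<Longrightarrow> Q s" and "1 + n * (k + 1) \<le> k'"
  shows "runs (While b c) s k' Q"
proof -
  have "\<exists>T s'. exec (While b c) s T s' \<and> T \<le> 1 + n * (k + 1) \<and> Q s'"
    using \<open>I n s\<close>
  proof (induction n arbitrary: s rule: less_induct)
    case (less n)
    show ?case
    proof (cases "test_holds b s")
      case False
      then show ?thesis using exec.WhileFalse[OF False] post[OF less.prems] by fastforce
    next
      case True
      obtain T s1 m where 1: "exec c s T s1" "T \<le> k" "I m s1" "m < n"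
        using step[OF less.prems True] by (auto simp: runs_def)
      obtain U s2 where 2: "exec (While b c) s1 U s2" "U \<le> 1 + m * (k + 1)" "Q s2"
        using less.IH[OF 1(4) 1(3)] by blast
      have "(m + 1) * (k + 1) \<le> n * (k + 1)"
        using 1(4) by (intro mult_le_mono1) simp
      then have "1 + T + U \<le> 1 + n * (k + 1)"
        using 1(2) 2(2) by (simp add: algebra_simps)
      then show ?thesis using exec.WhileTrue[OF True 1(1) 2(1)] 2(3) by blast
    qed
  qed
  then show ?thesis using assms(4) unfolding runs_def by (meson le_trans)
qed

lemma runs_While:
  fixes \<mu> :: "state \<Rightarrow> nat"
  assumes step: "\<And>s. I s \<Longrightarrow> test_holds b s \<Longrightarrow> runs c s k (\<lambda>s'. I s' \<and> \<mu> s' < \<mu> s)"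
    and "I s" and post: "\<And>s. I s \<Longrightarrow> \<not> test_holds b s \<Longrightarrow> Q s" and "1 + \<mu> s * (k + 1) \<le> k'"
  shows "runs (While b c) s k' Q"
proof (rule runs_While_variant[where I = "\<lambda>n s. I s \<and> \<mu> s = n"])
  show "runs c s k (\<lambda>s'. \<exists>m<n. I s' \<and> \<mu> s' = m)" if "I s \<and> \<mu> s = n" "test_holds b s" for n s
    using that by (intro runs_mono[OF step]) auto
qed (use assms in auto)

section \<open>Symbolic execution of loop-free code, and counting loops\<close>

fun straight :: "com \<Rightarrow> bool" where
  "straight (Seq c d) \<longleftrightarrow> straight c \<and> straight d"
| "straight (Cond b c d) \<longleftrightarrow> straight c \<and> straight d"
| "straight (While b c) \<longleftrightarrow> False"
| "straight c \<longleftrightarrow> True"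

fun result :: "com \<Rightarrow> state \<Rightarrow> state" where
  "result Skip s = s"
| "result (Const x k) s = set_reg x k s"
| "result (Copy x y) s = set_reg x (reg s y) s"
| "result (Inc x) s = set_reg x (reg s x + 1) s"
| "result (Dec x) s = set_reg x (reg s x - 1) s"
| "result (Load x a i) s = set_reg x (arr s a (reg s i)) s"
| "result (Store a i x) s = set_arr a (reg s i) (reg s x) s"
| "result (Emit x) s = emit (reg s x) s"
| "result (Seq c d) s = result d (result c s)"
| "result (Cond b c d) s = (if test_holds b s then result c s else result d s)"
| "result (While b c) s = s"

fun max_time :: "com \<Rightarrow> nat" where
  "max_time (Seq c d) = max_time c + max_time d"
| "max_time (Cond b c d) = 1 + max (max_time c) (max_time d)"
| "max_time c = 1"

text \<open>Reduces loop-free code to evaluating \<open>result\<close> by simplification. The time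
  bound takes the worse branch of each conditional and so is the same in all states.\<close>

lemma runs_straight:
  "straight c \<Longrightarrow> Q (result c s) \<Longrightarrow> max_time c \<le> k \<Longrightarrow> runs c s k Q"
proof (induction c arbitrary: s k Q)
  case (Seq c d)
  show ?case
  proof (rule runs_Seq)
    show "runs c s (max_time c) (\<lambda>s'. s' = result c s)" using Seq by simp
    show "runs d s' (max_time d) Q" if "s' = result c s" for s' using Seq that by simp
  qed (use Seq.prems in simp)
next
  case (Cond b c d)
  show ?case
    by (rule runs_Cond[where k = "max (max_time c) (max_time d)"]) (use Cond in auto)
next
  case (Emit x)
  then show ?case using exec.Emit[of x s] by (auto simp: runs_def emit_def)
qed (simp_all add: runs_def, (metis exec.intros(1-7)[simplified])+)

definition For :: "nat \<Rightarrow> nat \<Rightarrow> com \<Rightarrow> com" where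
  "For x n c = Seq (Const x 0) (While (Less x n) (Seq c (Inc x)))"

text \<open>The bound is stated with some \<open>z > n\<close>, so that one quantity can serve all
  loops; the strict inequality pays for the initialisation and the last test. \<open>frame\<close>
  lets the counter move without disturbing the invariant.\<close>

lemma runs_For:
  assumes init: "I 0 s"
    and step: "\<And>j s. j < n \<Longrightarrow> I j s \<Longrightarrow> reg s x = j \<Longrightarrow> runs c s b (\<lambda>s'. reg s' x = j \<and> I (Suc j) s')"
    and frame: "\<And>j v s. I j s \<Longrightarrow> I j (set_reg x v s)"
    and bound: "\<And>j s. I j s \<Longrightarrow> reg s r = n"
    and post: "\<And>s. I n s \<Longrightarrow> Q s"
    and time: "n < z" "(b + 3) * z \<le> k"
  shows "runs (For x r c) s k Q"
  unfolding For_def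
proof (rule runs_Seq)
  let ?J = "\<lambda>s. reg s x \<le> n \<and> I (reg s x) s"
  let ?b = "1 + (n - 0) * (b + 2)"
  show "runs (Const x 0) s 1 (\<lambda>s. ?J s \<and> reg s x = 0)"
    by (rule runs_straight) (simp_all add: frame init)
  show "runs (While (Less x r) (Seq c (Inc x))) s' ?b Q" if "?J s' \<and> reg s' x = 0" for s'
  proof (rule runs_While[where I = ?J and \<mu> = "\<lambda>s. n - reg s x" and k = "b + 1"])
    fix s1 assume 1: "?J s1" "test_holds (Less x r) s1"
    then have lt: "reg s1 x < n" using bound by fastforce
    show "runs (Seq c (Inc x)) s1 (b + 1) (\<lambda>s'. ?J s' \<and> n - reg s' x < n - reg s1 x)"
    proof (rule runs_Seq)
      show "runs c s1 b (\<lambda>s'. reg s' x = reg s1 x \<and> I (Suc (reg s1 x)) s')"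
        using step[OF lt] 1 by blast
      show "runs (Inc x) s2 1 (\<lambda>s'. ?J s' \<and> n - reg s' x < n - reg s1 x)"
        if "reg s2 x = reg s1 x \<and> I (Suc (reg s1 x)) s2" for s2
        using that lt by (intro runs_straight) (auto simp: frame)
    qed simp
  next
    fix s1 assume "?J s1" "\<not> test_holds (Less x r) s1"
    then show "Q s1" using bound[of "reg s1 x" s1] post by auto
  qed (use that in auto)
  have "(n + 1) * (b + 3) \<le> k"
    using time mult_le_mono1[of "n + 1" z "b + 3"] by (simp add: mult.commute)
  then show "1 + ?b \<le> k" by (simp add: algebra_simps)
qed

section \<open>The growth rate\<close>

lemma alpha_root: "t \<ge> 2 \<Longrightarrow> alpha t ^ t = (\<Sum>i<t. alpha t ^ i)"
  using Max_in[OF alpha_roots_finite alpha_roots_nonempty, of t] by (simp add: alpha_def)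

text \<open>The difference of the two sides is negative at 1 and equals 1 at 2, so it has a root in
  between, and \<open>alpha t\<close> is the largest root.\<close>

lemma alpha_gt_1:
  assumes "t \<ge> 2"
  shows "alpha t > 1"
proof -
  let ?f = "\<lambda>x::real. x ^ t - (\<Sum>i<t. x ^ i)"
  have f1: "?f 1 < 0" using assms by simp
  have "?f 2 = 1"
    using power_diff_1_eq[of "2::real" t] by simp
  moreover have "continuous_on {1..2} ?f"
    by (intro continuous_intros)
  ultimately obtain x where x: "?f x = 0" "1 \<le> x"
    using IVT'[of ?f 1 0 2] f1 by auto
  then have "x > 1" using f1 by (cases "x = 1") auto
  moreover have "x \<le> alpha t"
    unfolding alpha_def using x by (intro Max_ge[OF alpha_roots_finite]) simp
  ultimately show ?thesis by simp
qed

text \<open>The ratio of \<open>T(n - 1) + ... + T(n - j)\<close> to \<open>T(n)\<close> for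
  \<open>T(n) = a ^ n\<close>.\<close>

definition branch_weight :: "real \<Rightarrow> nat \<Rightarrow> real" where
  "branch_weight a j = (\<Sum>i<j. inverse a ^ Suc i)"

lemma branch_weight_Suc: "branch_weight a (Suc j) = inverse a + inverse a * branch_weight a j"
  unfolding branch_weight_def sum.lessThan_Suc_shift by (simp add: sum_distrib_left)

lemma branch_weight_mono: "a > 0 \<Longrightarrow> i \<le> j \<Longrightarrow> branch_weight a i \<le> branch_weight a j"
  unfolding branch_weight_def by (intro sum_mono2) auto

text \<open>This is the defining equation of \<open>alpha t\<close> divided by
  \<open>alpha t ^ t\<close>: clauses with \<open>t\<close> unassigned atoms are the critical
  case.\<close>

lemma branch_weight_alpha:
  assumes "t \<ge> 2"
  shows "branch_weight (alpha t) t = 1"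
proof -
  have pos: "alpha t > 0" using alpha_gt_1[OF assms] by simp
  have "alpha t ^ t * branch_weight (alpha t) t = (\<Sum>i<t. alpha t ^ (t - Suc i))"
    unfolding branch_weight_def sum_distrib_left
  proof (intro sum.cong refl)
    fix i assume "i \<in> {..<t}"
    then have "alpha t ^ t = alpha t ^ (t - Suc i) * alpha t ^ Suc i"
      by (simp flip: power_add del: power_Suc)
    moreover have "alpha t ^ Suc i * inverse (alpha t) ^ Suc i = 1"
      using pos by (simp flip: power_mult_distrib del: power_Suc)
    ultimately show "alpha t ^ t * inverse (alpha t) ^ Suc i = alpha t ^ (t - Suc i)"
      by (metis mult.assoc mult.right_neutral)
  qed
  also have "\<dots> = alpha t ^ t"
    using alpha_root[OF assms] sum.nat_diff_reindex[of "\<lambda>i. alpha t ^ i" t] by simp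
  finally show ?thesis using pos by simp
qed

text \<open>
  The number of search tree nodes over \<open>n\<close> unassigned atoms is at most \<open>tree_const t * alpha t ^ n - 3\<close>.
  The subtracted 3 absorbs the inner nodes when \<open>j \<ge> 2\<close>; the two lower bounds in the maximum handle
  \<open>j = 0\<close> and \<open>j = 1\<close>.
\<close>

definition tree_const :: "nat \<Rightarrow> real" where
  "tree_const t = max 4 (2 / (1 - inverse (alpha t)))"

text \<open>Passes from the count for an open clause with \<open>j\<close> unassigned atoms to a
  count in terms of \<open>n\<close> alone, which closes the induction in
  \<open>visit_length\<close>.\<close>

lemma branching_bound:
  assumes "t \<ge> 2" "j \<le> t"
  shows "tree_const t * alpha t ^ n * branch_weight (alpha t) j - 2 * real j + 1
    \<le> tree_const t * alpha t ^ n - 3"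
proof -
  let ?a = "alpha t" and ?A = "tree_const t" and ?S = "branch_weight (alpha t) j"
  have a: "?a > 1" using alpha_gt_1 assms by simp
  have b: "inverse ?a < 1" using a by (simp add: inverse_less_1_iff)
  have A: "?A \<ge> 4" "?A \<ge> 2 / (1 - inverse ?a)" by (simp_all add: tree_const_def)
  have x: "?a ^ n \<ge> 1" using a by simp
  consider "j = 0" | "j = 1" | "j \<ge> 2" by linarith
  then show ?thesis
  proof cases
    case 1
    have "4 * 1 \<le> ?A * ?a ^ n" using A x by (intro mult_mono) auto
    then show ?thesis using 1 by (simp add: branch_weight_def)
  next
    case 2
    \<comment> \<open>For \<open>j = 1\<close> the weight is \<open>inverse ?a\<close>, and the
      claim becomes \<open>2 \<le> ?A * ?a ^ n * (1 - inverse ?a)\<close>; the second argument of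
      the maximum in \<open>tree_const\<close> is made for this.\<close>
    have "2 \<le> ?A * (1 - inverse ?a)" using A(2) b by (simp add: divide_le_eq)
    also have "\<dots> \<le> (?A * (1 - inverse ?a)) * ?a ^ n"
      using A(1) b mult_left_mono[OF x, of "?A * (1 - inverse ?a)"] by simp
    finally show ?thesis using 2 by (simp add: branch_weight_def algebra_simps)
  next
    case 3
    have "?S \<le> 1" using branch_weight_mono[of ?a j t] branch_weight_alpha[of t] assms a by simp
    then have "?A * ?a ^ n * ?S \<le> ?A * ?a ^ n"
      using A(1) x mult_left_mono[of ?S 1 "?A * ?a ^ n"] by simp
    then show ?thesis using 3 by simp
  qed
qed

section \<open>Occurrences of atoms\<close>

text \<open>
  All references stored by the machine program are shifted by one, so that 0, the initial content of
  every array, means \<open>none\<close>.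
\<close>

primrec last_such :: "(nat \<Rightarrow> bool) \<Rightarrow> nat \<Rightarrow> nat" where
  "last_such Q 0 = 0"
| "last_such Q (Suc n) = (if Q n then Suc n else last_such Q n)"

lemma last_such_0_iff: "last_such Q n = 0 \<longleftrightarrow> (\<forall>i<n. \<not> Q i)"
  by (induction n) (auto simp: less_Suc_eq)

lemma last_such_SucD:
  "last_such Q n = Suc i \<Longrightarrow> i < n \<and> Q i \<and> (\<forall>j. i < j \<and> j < n \<longrightarrow> \<not> Q j)"
  by (induction n) (auto simp: less_Suc_eq split: if_splits)

lemma last_such_SucI:
  "i < n \<Longrightarrow> Q i \<Longrightarrow> (\<And>j. i < j \<Longrightarrow> j < n \<Longrightarrow> \<not> Q j) \<Longrightarrow> last_such Q n = Suc i"
  by (cases "last_such Q n") (metis last_such_0_iff last_such_SucD linorder_neqE_nat)+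

text \<open>
  Occurrences carry the input tags: 1 for the head, 2 for a positive and 3 for a negated body atom.
  Read as a disjunction of literals, the clause contains the atom negatively exactly for tag 2.
\<close>

lemma ex_less_Suc: "(\<exists>l<Suc j. Q l) \<longleftrightarrow> Q j \<or> (\<exists>l<j. Q l)"
  by (auto simp: less_Suc_eq)

definition clause_occs :: "clause_rep \<Rightarrow> (nat \<times> nat) list" where
  "clause_occs r = (case fst r of None \<Rightarrow> [] | Some p \<Rightarrow> [(1, p)]) @
     map (\<lambda>l. case l of Pos a \<Rightarrow> (2, a) | Neg a \<Rightarrow> (3, a)) (snd r)"

lemma clause_occs_iff:
  "(1, a) \<in> set (clause_occs r) \<longleftrightarrow> head (clause_of r) = Some a"
  "(2, a) \<in> set (clause_occs r) \<longleftrightarrow> Pos a \<in> body (clause_of r)"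
  "(3, a) \<in> set (clause_occs r) \<longleftrightarrow> Neg a \<in> body (clause_of r)"
  by (auto simp: clause_occs_def clause_of_def image_iff split: option.splits literal.splits)
    (metis literal.exhaust)+

lemma clause_occs_tag: "(g, a) \<in> set (clause_occs r) \<Longrightarrow> g \<in> {1, 2, 3}"
  by (auto simp: clause_occs_def split: option.splits literal.splits)

primrec occs :: "nat \<Rightarrow> clause_rep list \<Rightarrow> (nat \<times> nat \<times> nat) list" where
  "occs k [] = []"
| "occs k (r # R) = map (\<lambda>(g, a). (g, a, k)) (clause_occs r) @ occs (Suc k) R"

lemma occs_iff:
  "(g, a, k) \<in> set (occs k0 R) \<longleftrightarrow> k0 \<le> k \<and> k < k0 + length R \<and> (g, a) \<in> set (clause_occs (R ! (k - k0)))"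
proof (induction R arbitrary: k0)
  case (Cons r R)
  have 1: "(g, a, k) \<in> set (occs k0 (r # R)) \<longleftrightarrow>
    k = k0 \<and> (g, a) \<in> set (clause_occs r) \<or> (g, a, k) \<in> set (occs (Suc k0) R)"
    by auto
  have 2: "(r # R) ! (k - k0) = R ! (k - Suc k0)" if "k0 < k"
    using that by (simp add: nth_Cons' flip: diff_Suc_eq_diff_pred)
  show ?case
    unfolding 1 Cons.IH using 2 by (cases k k0 rule: linorder_cases) (simp_all add: Suc_le_eq)
qed auto

text \<open>Each clause occupies a consecutive stretch of the occurrence list; the linear-time
  tautology test rests on this.\<close>

lemma sorted_occs: "sorted (map (snd \<circ> snd) (occs k R))"
proof (induction R arbitrary: k)
  case (Cons r R)
  have "k \<le> k'" if "(g, a, k') \<in> set (occs (Suc k) R)" for g a k'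
    using that by (simp add: occs_iff)
  then show ?case
    using Cons[of "Suc k"] by (auto simp: sorted_append comp_def case_prod_beta map_replicate_const)
qed simp

lemma length_clause_occs:
  "distinct (snd r) \<Longrightarrow> length (clause_occs r) = clause_size (clause_of r)"
  by (auto simp: clause_occs_def clause_size_def clause_of_def distinct_card split: option.splits)

lemma length_occs: "length (occs k R) = (\<Sum>r\<leftarrow>R. length (clause_occs r))"
  by (induction R arbitrary: k) auto

lemma card_occs_of_clause:
  "card {l. l < length (occs k0 R) \<and> snd (snd (occs k0 R ! l)) = k} =
   (if k0 \<le> k \<and> k < k0 + length R then length (clause_occs (R ! (k - k0))) else 0)"
proof -
  have "length (filter (\<lambda>x. snd (snd x) = k) (occs k0 R)) =
    (if k0 \<le> k \<and> k < k0 + length R then length (clause_occs (R ! (k - k0))) else 0)"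
  proof (induction R arbitrary: k0)
    case (Cons r R)
    have 1: "length (filter (\<lambda>x. snd (snd x) = k) (map (\<lambda>(g, a). (g, a, k0)) xs)) =
      (if k = k0 then length xs else 0)" for xs :: "(nat \<times> nat) list"
      by (simp add: filter_map comp_def case_prod_beta)
    have 2: "(r # R) ! (k - k0) = R ! (k - Suc k0)" if "k0 < k"
      using that by (simp add: nth_Cons' flip: diff_Suc_eq_diff_pred)
    show ?case
      unfolding occs.simps filter_append length_append 1 Cons.IH
      using 2 by (cases k k0 rule: linorder_cases) (simp_all add: Suc_le_eq)
  qed auto
  then show ?thesis by (simp add: length_filter_conv_card)
qed

section \<open>The search tree\<close>

locale search =
  fixes t :: nat and P :: "nat clause set" and R :: "clause_rep list"
  assumes t2: "t \<ge> 2" and tprog: "t_program t P" and rep: "represents R P"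
begin

definition nocc :: nat where "nocc = length (occs 0 R)"
definition ncls :: nat where "ncls = length R"
definition tag :: "nat \<Rightarrow> nat" where "tag l = fst (occs 0 R ! l)"
definition atm :: "nat \<Rightarrow> nat" where "atm l = fst (snd (occs 0 R ! l))"
definition cls :: "nat \<Rightarrow> nat" where "cls l = snd (snd (occs 0 R ! l))"

lemma occ_iff:
  "(\<exists>l<nocc. tag l = g \<and> atm l = a \<and> cls l = k) \<longleftrightarrow> k < ncls \<and> (g, a) \<in> set (clause_occs (R ! k))"
proof -
  have "(\<exists>l<nocc. tag l = g \<and> atm l = a \<and> cls l = k) \<longleftrightarrow> (g, a, k) \<in> set (occs 0 R)"
    by (simp add: in_set_conv_nth nocc_def tag_def atm_def cls_def prod_eq_iff)
  then show ?thesis by (simp add: occs_iff ncls_def)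
qed

lemma cls_less: "l < nocc \<Longrightarrow> cls l < ncls"
  using occ_iff[of "tag l" "atm l" "cls l"] by blast

lemma tag_cases: "l < nocc \<Longrightarrow> tag l = 1 \<or> tag l = 2 \<or> tag l = 3"
  using occ_iff[of "tag l" "atm l" "cls l"] clause_occs_tag by fastforce

lemma cls_mono: "l \<le> l' \<Longrightarrow> l' < nocc \<Longrightarrow> cls l \<le> cls l'"
  using sorted_nth_mono[OF sorted_occs[of 0 R], of l l'] by (simp add: cls_def nocc_def)

definition cl :: "nat \<Rightarrow> nat clause" where "cl k = clause_of (R ! k)"

lemma P_eq: "P = cl ` {..<ncls}"
proof -
  have "P = set (map clause_of R)" using rep by (auto simp: represents_def)
  also have "\<dots> = cl ` {..<ncls}"
    by (auto simp: cl_def ncls_def set_conv_nth) (metis nth_map)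
  finally show ?thesis .
qed

lemma head_iff: "k < ncls \<Longrightarrow> head (cl k) = Some a \<longleftrightarrow> (\<exists>l<nocc. tag l = 1 \<and> atm l = a \<and> cls l = k)"
  and pos_iff: "k < ncls \<Longrightarrow> Pos a \<in> body (cl k) \<longleftrightarrow> (\<exists>l<nocc. tag l = 2 \<and> atm l = a \<and> cls l = k)"
  and neg_iff: "k < ncls \<Longrightarrow> Neg a \<in> body (cl k) \<longleftrightarrow> (\<exists>l<nocc. tag l = 3 \<and> atm l = a \<and> cls l = k)"
  by (simp_all only: occ_iff clause_occs_iff cl_def simp_thms)

lemma distinct_bodies: "r \<in> set R \<Longrightarrow> distinct (snd r)"
  using rep by (auto simp: represents_def)

lemma card_clause_occs: "card {l. l < nocc \<and> cls l = k} \<le> t"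
proof -
  have "length (clause_occs (R ! k)) \<le> t" if "k < ncls"
  proof -
    have "length (clause_occs (R ! k)) = clause_size (cl k)"
      unfolding cl_def using that by (intro length_clause_occs distinct_bodies) (simp add: ncls_def)
    then show ?thesis using that tprog P_eq by (auto simp: t_program_def)
  qed
  then show ?thesis
    unfolding nocc_def cls_def card_occs_of_clause by (auto simp: ncls_def)
qed

lemma nocc_eq: "nocc = program_size P"
proof -
  have "nocc = (\<Sum>r\<leftarrow>R. clause_size (clause_of r))"
    unfolding nocc_def length_occs
    by (intro arg_cong[of _ _ sum_list] map_cong refl length_clause_occs distinct_bodies)
  also have "\<dots> = sum clause_size (set (map clause_of R))"
    using rep sum_list_distinct_conv_sum_set[of "map clause_of R" clause_size]
    by (simp add: represents_def comp_def)
  finally show ?thesis using rep by (simp add: program_size_def represents_def)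
qed

text \<open>The only clause of size 0 is the empty constraint, which a set of clauses contains at
  most once.\<close>

lemma ncls_le: "ncls \<le> Suc nocc"
proof -
  have fin: "finite P" "\<And>r. r \<in> P \<Longrightarrow> finite (body r)"
    using tprog by (auto simp: t_program_def logic_program_def)
  have "ncls = card P"
    using rep distinct_card[of "map clause_of R"] by (simp add: represents_def ncls_def)
  also have "\<dots> = (\<Sum>r\<in>P. 1)" by simp
  also have "\<dots> \<le> (\<Sum>r\<in>P. (if r = Clause None {} then 1 else 0) + clause_size r)"
  proof (rule sum_mono)
    fix r assume "r \<in> P"
    then show "1 \<le> (if r = Clause None {} then 1 else 0) + clause_size r"
      using fin(2)[of r] by (cases r) (auto simp: clause_size_def Suc_le_eq card_gt_0_iff split: option.splits)
  qed
  also have "\<dots> \<le> 1 + program_size P"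
    using fin(1) by (simp add: sum.distrib program_size_def sum.If_cases card_le_Suc0_iff_eq)
  finally show ?thesis by (simp add: nocc_eq)
qed

lemma atoms_eq: "atoms P = atm ` {..<nocc}"
proof (intro equalityI subsetI)
  fix a assume "a \<in> atoms P"
  then obtain k where k: "k < ncls" and "head (cl k) = Some a \<or> (\<exists>l\<in>body (cl k). atom_of l = a)"
    by (auto simp: atoms_def P_eq)
  then have "head (cl k) = Some a \<or> Pos a \<in> body (cl k) \<or> Neg a \<in> body (cl k)"
    by (auto, metis literal.exhaust_sel)
  then show "a \<in> atm ` {..<nocc}"
    using head_iff[OF k] pos_iff[OF k] neg_iff[OF k] by auto
next
  fix a assume "a \<in> atm ` {..<nocc}"
  then obtain l where l: "l < nocc" "a = atm l" by auto
  let ?k = "cls l"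
  have "head (cl ?k) = Some a \<or> Pos a \<in> body (cl ?k) \<or> Neg a \<in> body (cl ?k)"
    using tag_cases[OF l(1)] l cls_less[OF l(1)] by (auto simp: head_iff pos_iff neg_iff)
  then show "a \<in> atoms P"
    using cls_less[OF l(1)] by (force simp: atoms_def P_eq)
qed

lemma finite_atoms: "finite (atoms P)" by (simp add: atoms_eq)

definition natoms :: nat where "natoms = card (atoms P)"

lemma natoms_le: "natoms \<le> nocc"
  unfolding natoms_def atoms_eq using card_image_le[of "{..<nocc}" atm] by simp

section \<open>Clauses as disjunctions, stable models as minimal models\<close>

lemma sat_cl_iff:
  assumes "k < ncls"
  shows "sat_clause M (cl k) \<longleftrightarrow> (\<exists>l<nocc. cls l = k \<and> (atm l \<in> M \<longleftrightarrow> tag l \<noteq> 2))"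
proof
  assume "sat_clause M (cl k)"
  then consider a where "head (cl k) = Some a" "a \<in> M" | l where "l \<in> body (cl k)" "\<not> sat_literal M l"
    by (auto simp: sat_clause_def)
  then show "\<exists>l<nocc. cls l = k \<and> (atm l \<in> M \<longleftrightarrow> tag l \<noteq> 2)"
  proof cases
    case 1
    then show ?thesis using head_iff[OF assms] by force
  next
    case 2
    then show ?thesis using pos_iff[OF assms] neg_iff[OF assms] by (cases l) force+
  qed
next
  assume "\<exists>l<nocc. cls l = k \<and> (atm l \<in> M \<longleftrightarrow> tag l \<noteq> 2)"
  then obtain l where l: "l < nocc" "cls l = k" "atm l \<in> M \<longleftrightarrow> tag l \<noteq> 2" by blast
  show "sat_clause M (cl k)"
    using tag_cases[OF l(1)]
  proof (elim disjE)
    assume "tag l = 1"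
    then have "head (cl k) = Some (atm l)" using l head_iff[OF assms] by blast
    then show ?thesis using l \<open>tag l = 1\<close> by (simp add: sat_clause_def)
  next
    assume "tag l = 2"
    then have "Pos (atm l) \<in> body (cl k)" using l pos_iff[OF assms] by blast
    then show ?thesis using l \<open>tag l = 2\<close> unfolding sat_clause_def by fastforce
  next
    assume "tag l = 3"
    then have "Neg (atm l) \<in> body (cl k)" using l neg_iff[OF assms] by blast
    then show ?thesis using l \<open>tag l = 3\<close> unfolding sat_clause_def by fastforce
  qed
qed

lemma stable_is_model:
  assumes "stable_model P M"
  shows "is_model M P"
  unfolding is_model_def
proof
  fix r assume r: "r \<in> P"
  show "sat_clause M r"
  proof (cases "head r")
    case None
    then show ?thesis using assms r by (auto simp: stable_model_def is_model_def constraints_def)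
  next
    case (Some p)
    show ?thesis unfolding sat_clause_def
    proof
      assume b: "\<forall>l\<in>body r. sat_literal M l"
      then have "\<not> (\<exists>a\<in>M. Neg a \<in> body r)" by fastforce
      then have "Clause (head r) {l \<in> body r. \<exists>a. l = Pos a} \<in> reduct P M"
        using r Some unfolding reduct_def by blast
      then have "sat_clause M (Clause (head r) {l \<in> body r. \<exists>a. l = Pos a})"
        using assms by (simp add: stable_model_def is_least_model_def is_model_def)
      then show "\<exists>p\<in>set_option (head r). p \<in> M" using b by (simp add: sat_clause_def)
    qed
  qed
qed

text \<open>A clause survives in the reduct if its negated atoms avoid \<open>M\<close>; they then
  avoid \<open>N\<close> as well, so the deleted literals hold in \<open>N\<close> and the reduced
  clause says the same about \<open>N\<close> as the original one.\<close>

lemma model_of_reduct: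
  assumes "is_model N P" "N \<subseteq> M"
  shows "is_model N (reduct P M)"
  unfolding is_model_def
proof
  fix r' assume "r' \<in> reduct P M"
  then obtain r where r: "r' = Clause (head r) {l \<in> body r. \<exists>a. l = Pos a}" "r \<in> P"
    "\<not> (\<exists>a\<in>M. Neg a \<in> body r)" by (auto simp: reduct_def)
  have "sat_literal N l" if "\<forall>l\<in>body r'. sat_literal N l" "l \<in> body r" for l
    using that r assms(2) by (cases l) auto
  then show "sat_clause N r'"
    using assms(1) r unfolding is_model_def sat_clause_def by auto
qed

text \<open>\<open>N\<close> is a model of the reduct by \<open>model_of_reduct\<close>, so
  leastness of \<open>M\<close> gives the other inclusion.\<close>

lemma stable_minimal:
  assumes "stable_model P M" "is_model N P" "N \<subseteq> M"
  shows "N = M"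
  using assms model_of_reduct[OF assms(2,3)] by (auto simp: stable_model_def is_least_model_def)

section \<open>Partial assignments and the search tree\<close>

text \<open>The head of a trail is the most recent assignment.\<close>

type_synonym trail = "(nat \<times> bool) list"

text \<open>Either value of such an atom satisfies the clause, so no branch would keep the clause
  open; \<open>satisfied\<close> therefore counts it as satisfied from the start.\<close>

definition taut :: "nat \<Rightarrow> bool" where
  "taut k \<longleftrightarrow> (\<exists>l<nocc. \<exists>l'<nocc. cls l = k \<and> cls l' = k \<and> atm l = atm l' \<and> tag l = 2 \<and> tag l' \<noteq> 2)"

definition satisfied :: "trail \<Rightarrow> nat \<Rightarrow> bool" where
  "satisfied tr k \<longleftrightarrow> taut k \<or> (\<exists>l<nocc. cls l = k \<and> map_of tr (atm l) = Some (tag l \<noteq> 2))"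

definition open_clause :: "trail \<Rightarrow> nat" where
  "open_clause tr = last_such (\<lambda>k. \<not> satisfied tr k) ncls"

definition open_occ :: "trail \<Rightarrow> nat \<Rightarrow> nat" where
  "open_occ tr k = last_such (\<lambda>l. cls l = k \<and> map_of tr (atm l) = None) nocc"

text \<open>\<open>None\<close> covers two kinds of leaf: every clause is satisfied, or the open
  clause has no unassigned atom left and is false (a dead end).\<close>

definition pick :: "trail \<Rightarrow> nat option" where
  "pick tr = (case open_clause tr of 0 \<Rightarrow> None
     | Suc k \<Rightarrow> (case open_occ tr k of 0 \<Rightarrow> None | Suc l \<Rightarrow> Some (atm l)))"

text \<open>
  The first argument only bounds the depth; with the number of unassigned atoms as fuel the bound is
  never reached early (\<open>visit_unfold\<close>).
\<close>

primrec visit :: "nat \<Rightarrow> trail \<Rightarrow> trail list" where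
  "visit 0 tr = [tr]"
| "visit (Suc n) tr = tr # (case pick tr of None \<Rightarrow> []
     | Some a \<Rightarrow> visit n ((a, True) # tr) @ visit n ((a, False) # tr))"

definition valid :: "trail \<Rightarrow> bool" where
  "valid tr \<longleftrightarrow> distinct (map fst tr) \<and> fst ` set tr \<subseteq> atoms P"

lemma valid_length: "valid tr \<Longrightarrow> length tr \<le> natoms"
  unfolding valid_def natoms_def
  by (metis card_mono distinct_card finite_atoms length_map set_map)

lemma pick_SomeD:
  assumes "pick tr = Some a"
  obtains k l where "open_clause tr = Suc k" "open_occ tr k = Suc l" "l < nocc" "cls l = k" "a = atm l"
    "map_of tr a = None"
proof -
  obtain k where k: "open_clause tr = Suc k"
    using assms by (cases "open_clause tr") (simp_all add: pick_def)
  obtain l where l: "open_occ tr k = Suc l" "a = atm l"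
    using assms k by (cases "open_occ tr k") (simp_all add: pick_def)
  show thesis
    by (rule that[OF k l(1)]) (use l(2) last_such_SucD[OF l(1)[unfolded open_occ_def]] in simp_all)
qed

lemma pick_valid: "pick tr = Some a \<Longrightarrow> valid tr \<Longrightarrow> valid ((a, b) # tr)"
  by (elim pick_SomeD) (auto simp: valid_def atoms_eq map_of_eq_None_iff)

text \<open>A picked atom would extend the trail to a valid one with more entries than there are
  atoms.\<close>

lemma pick_None_full: "valid tr \<Longrightarrow> length tr = natoms \<Longrightarrow> pick tr = None"
  using pick_valid valid_length by (metis length_Cons not_less_eq_eq option.exhaust order_refl)

lemma visit_unfold:
  assumes "valid tr" "n + length tr = natoms"
  shows "visit n tr = tr # (case pick tr of None \<Rightarrow> []
     | Some a \<Rightarrow> visit (n - 1) ((a, True) # tr) @ visit (n - 1) ((a, False) # tr))"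
  using assms pick_None_full by (cases n) (auto split: option.split)

lemma pick_Some_fuel:
  "valid tr \<Longrightarrow> n + length tr = natoms \<Longrightarrow> pick tr = Some a \<Longrightarrow> n - 1 + length ((a, b) # tr) = natoms \<and> n > 0"
  using pick_None_full by (cases n) auto

section \<open>Counting the nodes\<close>

definition unassigned :: "trail \<Rightarrow> nat \<Rightarrow> nat set" where
  "unassigned tr k = {a. map_of tr a = None \<and> a \<in> atm ` {l. l < nocc \<and> cls l = k}}"

lemma finite_unassigned: "finite (unassigned tr k)"
  by (rule finite_subset[of _ "atm ` {l. l < nocc \<and> cls l = k}"]) (auto simp: unassigned_def)

lemma card_unassigned: "card (unassigned tr k) \<le> t"
proof -
  have "card (unassigned tr k) \<le> card (atm ` {l. l < nocc \<and> cls l = k})"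
    by (rule card_mono) (auto simp: unassigned_def)
  also have "\<dots> \<le> card {l. l < nocc \<and> cls l = k}" by (rule card_image_le) simp
  finally show ?thesis using card_clause_occs[of k] by simp
qed

text \<open>The value \<open>tag l = 2\<close> falsifies the literal at \<open>l\<close>. Other
  occurrences of the atom in the clause have the same sign because the clause is not a tautology, so
  none of them satisfies it; later clauses stay satisfied since the trail only grows.\<close>

lemma open_clause_branch:
  assumes "valid tr" and a: "map_of tr a = None" and l: "l < nocc" "cls l = k" "atm l = a"
    and k: "open_clause tr = Suc k"
  shows "open_clause ((a, tag l = 2) # tr) = Suc k"
proof -
  have un: "\<not> satisfied tr k" "k < ncls" "\<forall>j. k < j \<and> j < ncls \<longrightarrow> satisfied tr j"
    using k by (auto simp: open_clause_def dest!: last_such_SucD)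
  have "satisfied ((a, b) # tr) j" if "satisfied tr j" for b j
    using that a by (auto simp: satisfied_def)
  moreover have "\<not> satisfied ((a, tag l = 2) # tr) k"
  proof
    assume "satisfied ((a, tag l = 2) # tr) k"
    then obtain l' where "l' < nocc" "cls l' = k" "atm l' = a" "(tag l = 2) = (tag l' \<noteq> 2)"
      using un(1) by (auto simp: satisfied_def split: if_splits)
    then show False using un(1) l unfolding satisfied_def taut_def by metis
  qed
  ultimately show ?thesis
    unfolding open_clause_def using un by (intro last_such_SucI) auto
qed

text \<open>With \<open>j\<close> unassigned atoms in the open clause, one branch satisfies it and
  gets the general bound, the other keeps it open with \<open>j - 1\<close> and gets the refined
  bound. Each level adds 1 for its node and gains 3 from the satisfied branch, whence
  \<open>- 2 * j\<close>; the final \<open>+ 1\<close> is the dead end at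
  \<open>j = 0\<close>.\<close>

lemma visit_length:
  assumes "valid tr" "n + length tr = natoms"
  shows "length (visit n tr) \<le> tree_const t * alpha t ^ n - 3 \<and>
    (\<forall>k. open_clause tr = Suc k \<longrightarrow> length (visit n tr)
      \<le> tree_const t * alpha t ^ n * branch_weight (alpha t) (card (unassigned tr k))
        - 2 * card (unassigned tr k) + 1)"
  using assms
proof (induction n arbitrary: tr rule: less_induct)
  case (less n)
  note fuel = less.prems(2)
  have a: "alpha t > 1" using alpha_gt_1[OF t2] .
  have clause: "length (visit n tr)
      \<le> tree_const t * alpha t ^ n * branch_weight (alpha t) (card (unassigned tr k))
        - 2 * card (unassigned tr k) + 1" if k: "open_clause tr = Suc k" for k
  proof (cases "pick tr")
    case None
    then have "unassigned tr k = {}"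
      using k by (auto simp: pick_def open_occ_def last_such_0_iff unassigned_def split: nat.splits)
    then show ?thesis using visit_unfold[OF less.prems] None by (simp add: branch_weight_def)
  next
    case (Some a)
    from pick_SomeD[OF this] k obtain l where l: "l < nocc" "cls l = k" "atm l = a" "map_of tr a = None"
      by (metis nat.inject)
    obtain m where m: "n = Suc m" using pick_Some_fuel[OF less.prems Some] gr0_conv_Suc by blast
    have v: "valid ((a, b) # tr)" for b using pick_valid Some less.prems by blast
    have f: "m + length ((a, b) # tr) = natoms" for b using fuel m by simp
    \<comment> \<open>\<open>?b\<close> is the value that falsifies the picked literal, whichever
      its sign; \<open>\<not> ?b\<close> satisfies the clause.\<close>
    let ?b = "tag l = 2" and ?c = "card (unassigned tr k)"
    have "unassigned ((a, ?b) # tr) k = unassigned tr k - {a}" "a \<in> unassigned tr k"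
      using l by (auto simp: unassigned_def)
    then have c: "?c = Suc (card (unassigned ((a, ?b) # tr) k))"
      using card_Suc_Diff1[OF finite_unassigned] by metis
    have 1: "length (visit m ((a, \<not> ?b) # tr)) \<le> tree_const t * alpha t ^ m - 3"
      using less.IH[OF _ v f] m by simp
    have 2: "length (visit m ((a, ?b) # tr))
      \<le> tree_const t * alpha t ^ m * branch_weight (alpha t) (card (unassigned ((a, ?b) # tr) k))
        - 2 * card (unassigned ((a, ?b) # tr) k) + 1"
      using less.IH[OF _ v f] open_clause_branch[OF less.prems(1) l(4) l(1-3) k] m by simp
    have "length (visit n tr) = 1 + length (visit m ((a, ?b) # tr)) + length (visit m ((a, \<not> ?b) # tr))"
      using m Some by (cases ?b) auto
    moreover have "tree_const t * alpha t ^ n * branch_weight (alpha t) ?c =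
      tree_const t * alpha t ^ m + tree_const t * alpha t ^ m * branch_weight (alpha t) (card (unassigned ((a, ?b) # tr) k))"
      unfolding c branch_weight_Suc m using \<open>alpha t > 1\<close> by (simp add: field_simps)
    ultimately show ?thesis using 1 2 c by simp
  qed
  have "length (visit n tr) \<le> tree_const t * alpha t ^ n - 3"
  proof (cases "open_clause tr")
    case 0
    have "4 \<le> tree_const t" by (simp add: tree_const_def)
    moreover from this have "tree_const t * 1 \<le> tree_const t * alpha t ^ n"
      using a by (intro mult_left_mono) auto
    ultimately have "4 \<le> tree_const t * alpha t ^ n" by linarith
    then show ?thesis using visit_unfold[OF less.prems] 0 by (simp add: pick_def)
  next
    case (Suc k)
    then show ?thesis
      using clause[OF Suc] branching_bound[OF t2 card_unassigned[of tr k], of n] by linarith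
  qed
  then show ?case using clause by blast
qed

section \<open>Leaves, completeness and absence of repetitions\<close>

definition trues :: "trail \<Rightarrow> nat set" where
  "trues tr = {a. map_of tr a = Some True}"

definition accepted :: "trail \<Rightarrow> bool" where
  "accepted tr \<longleftrightarrow> open_clause tr = 0 \<and> stable_model P (trues tr)"

definition true_list :: "trail \<Rightarrow> nat list" where
  "true_list tr = map fst (filter snd (rev tr))"

definition report :: "trail \<Rightarrow> nat list" where
  "report tr = (if accepted tr then map Suc (true_list tr) @ [0] else [])"

lemma set_true_list: "valid tr \<Longrightarrow> set (true_list tr) = trues tr"
  by (auto simp: true_list_def trues_def valid_def image_iff map_of_eq_Some_iff)

lemma distinct_true_list: "valid tr \<Longrightarrow> distinct (true_list tr)"
  unfolding true_list_def valid_def distinct_map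
  by (auto intro: inj_on_subset)

definition agrees :: "nat set \<Rightarrow> trail \<Rightarrow> bool" where
  "agrees M tr \<longleftrightarrow> (\<forall>(a, b)\<in>set tr. a \<in> M \<longleftrightarrow> b)"

text \<open>Making the unassigned atoms false respects every assigned literal, and tautologies hold
  under any set.\<close>

lemma leaf_model:
  assumes "open_clause tr = 0"
  shows "is_model (trues tr) P"
proof -
  have "sat_clause (trues tr) (cl k)" if "k < ncls" for k
  proof -
    have "satisfied tr k" using assms that by (auto simp: open_clause_def last_such_0_iff)
    then consider "taut k" | l where "l < nocc" "cls l = k" "map_of tr (atm l) = Some (tag l \<noteq> 2)"
      unfolding satisfied_def by blast
    then show ?thesis
    proof cases
      case 1
      then show ?thesis unfolding sat_cl_iff[OF that] taut_def by metis
    next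
      case 2
      then have "atm l \<in> trues tr \<longleftrightarrow> tag l \<noteq> 2" by (simp add: trues_def)
      then show ?thesis unfolding sat_cl_iff[OF that] using 2 by blast
    qed
  qed
  then show ?thesis by (auto simp: is_model_def P_eq)
qed

lemma visit_valid: "valid tr \<Longrightarrow> tr' \<in> set (visit n tr) \<Longrightarrow> valid tr' \<and> (\<exists>pre. tr' = pre @ tr)"
proof (induction n arbitrary: tr)
  case (Suc n)
  show ?case
  proof (cases "tr' = tr")
    case False
    then obtain a b where "pick tr = Some a" "tr' \<in> set (visit n ((a, b) # tr))"
      using Suc.prems(2) by (cases "pick tr") auto
    then have "valid tr'" "\<exists>pre. tr' = pre @ (a, b) # tr"
      using Suc.IH pick_valid[OF _ Suc.prems(1)] by blast+
    then show ?thesis by (metis append.assoc append_Cons append_Nil)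
  qed (use Suc.prems in auto)
qed simp

text \<open>Giving each picked atom its value in \<open>M\<close> leads to a leaf where all clauses
  are satisfied. There the true atoms form a model contained in \<open>M\<close>, and minimality of
  stable models makes it equal to \<open>M\<close>.\<close>

lemma visit_complete:
  assumes "stable_model P M" "agrees M tr" "valid tr" "n + length tr = natoms"
  shows "\<exists>tr'\<in>set (visit n tr). accepted tr' \<and> trues tr' = M"
  using assms(2-)
proof (induction n arbitrary: tr rule: less_induct)
  case (less n)
  show ?case
  proof (cases "pick tr")
    case (Some a)
    let ?tr = "(a, a \<in> M) # tr"
    have "\<exists>tr'\<in>set (visit (n - 1) ?tr). accepted tr' \<and> trues tr' = M"
      using less.prems pick_Some_fuel[OF less.prems(2,3) Some]
      by (intro less.IH) (auto simp: agrees_def pick_valid[OF Some less.prems(2)])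
    moreover have "set (visit (n - 1) ?tr) \<subseteq> set (visit n tr)"
      using visit_unfold[OF less.prems(2,3)] Some by (cases "a \<in> M") auto
    ultimately show ?thesis by blast
  next
    case None
    \<comment> \<open>No dead end lies on this path: the trail would falsify all literals of the
      open clause, and so would \<open>M\<close>, which is a model.\<close>
    have leaf: "open_clause tr = 0"
    proof (rule ccontr)
      assume "open_clause tr \<noteq> 0"
      then obtain k where k: "open_clause tr = Suc k" using not0_implies_Suc by blast
      then have un: "\<not> satisfied tr k" "k < ncls"
        by (auto simp: open_clause_def dest!: last_such_SucD)
      have full: "map_of tr (atm l) \<noteq> None" if "l < nocc" "cls l = k" for l
        using that None k by (auto simp: pick_def open_occ_def last_such_0_iff split: nat.splits)
      have "sat_clause M (cl k)"
        using stable_is_model[OF assms(1)] un(2) by (auto simp: is_model_def P_eq)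
      then obtain l where l: "l < nocc" "cls l = k" "atm l \<in> M \<longleftrightarrow> tag l \<noteq> 2"
        using sat_cl_iff[OF un(2)] by blast
      obtain b where b: "map_of tr (atm l) = Some b" using full[OF l(1,2)] by blast
      then have "b \<longleftrightarrow> atm l \<in> M" using less.prems(1) map_of_SomeD[OF b] by (auto simp: agrees_def)
      then show False using un(1) l b unfolding satisfied_def by auto
    qed
    have "trues tr \<subseteq> M"
      using less.prems(1) by (auto simp: trues_def agrees_def dest!: map_of_SomeD)
    then have "trues tr = M" using stable_minimal[OF assms(1) leaf_model[OF leaf]] by blast
    then have "accepted tr" using leaf assms(1) by (simp add: accepted_def)
    moreover have "tr \<in> set (visit n tr)" using visit_unfold[OF less.prems(2,3)] by simp
    ultimately show ?thesis using \<open>trues tr = M\<close> by blast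
  qed
qed

text \<open>Accepted nodes are leaves, and two of them below different branches disagree on the atom
  picked at the branching, whose value is fixed from there on.\<close>

lemma visit_distinct:
  "valid tr \<Longrightarrow> distinct (map trues (filter accepted (visit n tr)))"
proof (induction n arbitrary: tr)
  case (Suc n)
  show ?case
  proof (cases "pick tr")
    case (Some a)
    let ?F = "\<lambda>b. map trues (filter accepted (visit n ((a, b) # tr)))"
    have "\<not> accepted tr" using Some by (auto simp: accepted_def pick_def)
    then have "map trues (filter accepted (visit (Suc n) tr)) = ?F True @ ?F False"
      using Some by simp
    moreover have v: "valid ((a, b) # tr)" for b using pick_valid Some Suc.prems by blast
    have mem: "a \<in> trues tr' \<longleftrightarrow> b" if "tr' \<in> set (visit n ((a, b) # tr))" for tr' b
    proof -
      from visit_valid[OF v that] obtain pre where "valid tr'" "tr' = pre @ (a, b) # tr" by blast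
      then have "map_of tr' a = Some b" by (simp add: valid_def map_of_eq_Some_iff del: map_of_append)
      then show ?thesis by (simp add: trues_def)
    qed
    have "a \<in> M \<longleftrightarrow> b" if "M \<in> set (?F b)" for M b
      using that mem[of _ b] by auto
    then have "set (?F True) \<inter> set (?F False) = {}" by blast
    ultimately show ?thesis using Suc.IH[OF v] by (simp only: distinct_append simp_thms)
  qed simp
qed simp

lemma valid_Nil: "valid []" by (simp add: valid_def)

lemma concat_map_filter: "concat (map f (filter Q xs)) = concat (map (\<lambda>x. if Q x then f x else []) xs)"
  by (induction xs) auto

lemma visit_enumerates:
  "enumerates (concat (map report (visit natoms []))) {M. stable_model P M}"
proof -
  let ?V = "filter accepted (visit natoms [])"
  have v: "valid tr" if "tr \<in> set ?V" for tr using that visit_valid[OF valid_Nil] by auto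
  have s: "map set (map true_list ?V) = map trues ?V" using v set_true_list by simp
  have "set (map trues ?V) = {M. stable_model P M}"
  proof (intro equalityI subsetI)
    fix M assume "M \<in> {M. stable_model P M}"
    then obtain tr where "tr \<in> set (visit natoms [])" "accepted tr" "trues tr = M"
      using visit_complete[of M "[]" natoms] valid_Nil by (auto simp: agrees_def)
    then show "M \<in> set (map trues ?V)" by auto
  qed (auto simp: accepted_def)
  moreover have "concat (map report (visit natoms [])) = concat (map (\<lambda>L. map Suc L @ [0]) (map true_list ?V))"
    by (simp add: comp_def concat_map_filter report_def[abs_def])
  moreover have "\<forall>L\<in>set (map true_list ?V). distinct L"
    using v distinct_true_list by auto
  ultimately show ?thesis
    unfolding enumerates_def
    by (intro exI[of _ "map true_list ?V"] conjI) (simp_all only: s visit_distinct[OF valid_Nil])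
qed

text \<open>
  As the branch \<open>True\<close> always comes first, the truth values on the trail tell which branches are
  still to be explored, and no further bookkeeping is needed.
\<close>

fun backtrack :: "trail \<Rightarrow> trail option" where
  "backtrack [] = None"
| "backtrack ((a, b) # tr) = (if b then Some ((a, False) # tr) else backtrack tr)"

text \<open>The nodes that follow the subtree at the current trail: every \<open>True\<close> entry
  still owes the subtree of its \<open>False\<close> sibling, the most recent entry first.\<close>

fun pending :: "trail \<Rightarrow> trail list" where
  "pending [] = []"
| "pending ((a, b) # tr) =
     (if b then visit (natoms - Suc (length tr)) ((a, False) # tr) else []) @ pending tr"

lemma backtrack_None: "backtrack tr = None \<Longrightarrow> pending tr = []"
  by (induction tr rule: backtrack.induct) (auto split: if_splits)

lemma backtrack_Some:
  "backtrack tr = Some tr' \<Longrightarrow> valid tr \<Longrightarrow>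
    valid tr' \<and> pending tr = visit (natoms - length tr') tr' @ pending tr'"
  by (induction tr rule: backtrack.induct) (auto simp: valid_def image_subset_iff split: if_splits)

text \<open>The rest of the preorder traversal from the current node on; its length is the variant
  of the main loop.\<close>

definition remaining :: "trail \<Rightarrow> trail list" where
  "remaining tr = visit (natoms - length tr) tr @ pending tr"

lemma remaining_leaf:
  assumes "valid tr" "pick tr = None"
  shows "remaining tr = tr # (case backtrack tr of None \<Rightarrow> [] | Some tr' \<Rightarrow> remaining tr')"
  using assms visit_unfold[of tr "natoms - length tr"] valid_length[of tr]
  by (auto simp: remaining_def backtrack_None backtrack_Some split: option.splits)

lemma remaining_branch:
  assumes "valid tr" "pick tr = Some a"
  shows "remaining tr = tr # remaining ((a, True) # tr)"
  using assms visit_unfold[of tr "natoms - length tr"] valid_length[of tr]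
  by (auto simp: remaining_def)

end

section \<open>The program\<close>

notation Seq (infixr ";;" 60)

abbreviation (input) "rN \<equiv> 0 :: nat"
abbreviation (input) "rL \<equiv> 2 :: nat"
abbreviation (input) "rK \<equiv> 3 :: nat"
abbreviation (input) "rOne \<equiv> 4 :: nat"
abbreviation (input) "rTwo \<equiv> 5 :: nat"
abbreviation (input) "rThree \<equiv> 6 :: nat"
abbreviation (input) "rZero \<equiv> 7 :: nat"
abbreviation (input) "rX \<equiv> 8 :: nat"
abbreviation (input) "rD \<equiv> 9 :: nat"
abbreviation (input) "rGo \<equiv> 10 :: nat"
abbreviation (input) "rG \<equiv> 11 :: nat"
abbreviation (input) "rA \<equiv> 12 :: nat"
abbreviation (input) "rC \<equiv> 13 :: nat"
abbreviation (input) "rY \<equiv> 14 :: nat"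
abbreviation (input) "rF \<equiv> 15 :: nat"
abbreviation (input) "rV \<equiv> 16 :: nat"
abbreviation (input) "rTail \<equiv> 17 :: nat"
abbreviation (input) "rHead \<equiv> 18 :: nat"
abbreviation (input) "rO \<equiv> 19 :: nat"
abbreviation (input) "rW \<equiv> 20 :: nat"

abbreviation (input) "aIn \<equiv> 0 :: nat"
abbreviation (input) "aTag \<equiv> 2 :: nat"
abbreviation (input) "aAtm \<equiv> 3 :: nat"
abbreviation (input) "aCls \<equiv> 4 :: nat"
abbreviation (input) "aPos \<equiv> 5 :: nat"
abbreviation (input) "aNext \<equiv> 6 :: nat"
abbreviation (input) "aMark \<equiv> 7 :: nat"
abbreviation (input) "aHead \<equiv> 8 :: nat"
abbreviation (input) "aTaut \<equiv> 9 :: nat"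
abbreviation (input) "aVal \<equiv> 10 :: nat"
abbreviation (input) "aDer \<equiv> 11 :: nat"
abbreviation (input) "aSat \<equiv> 12 :: nat"
abbreviation (input) "aOpen \<equiv> 13 :: nat"
abbreviation (input) "aCnt \<equiv> 14 :: nat"
abbreviation (input) "aQue \<equiv> 15 :: nat"
abbreviation (input) "aTrA \<equiv> 16 :: nat"
abbreviation (input) "aTrV \<equiv> 17 :: nat"

text \<open>
  Arrays indexed by occurrences: \<open>aTag\<close>, \<open>aAtm\<close>, \<open>aCls\<close>, and \<open>aNext\<close>, which links each positive body
  occurrence to the previous one of the same atom.  Arrays indexed by atoms: \<open>aPos\<close> and \<open>aMark\<close> (last
  occurrence with tag 2 and with another tag), \<open>aVal\<close> (0 unassigned, 1 true, 2 false), \<open>aDer\<close> (derived by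
  propagation).  Arrays indexed by clauses: \<open>aHead\<close>, \<open>aTaut\<close>, \<open>aSat\<close>, \<open>aOpen\<close> (an unassigned
  occurrence), \<open>aCnt\<close> (body literals not yet known to hold).  \<open>aQue\<close> is the queue of derived atoms, and
  \<open>aTrA\<close>, \<open>aTrV\<close> store the trail, oldest entry first.
\<close>

definition parse_body :: com where
  "parse_body = Load rG aIn rY ;; Inc rY ;;
     Cond (Equal rG rZero) (Inc rK)
       (Load rA aIn rY ;; Inc rY ;;
        Store aTag rL rG ;; Store aAtm rL rA ;; Store aCls rL rK ;; Inc rL)"

definition parse :: com where
  "parse = Const rOne 1 ;; Const rTwo 2 ;; Const rThree 3 ;; While (Less rY rN) parse_body"

text \<open>In both branches \<open>rF\<close> ends as the latest occurrence of the atom with the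
  opposite sign (shifted by one), so that one final test on its clause detects a tautology.\<close>

definition index_body :: com where
  "index_body = Load rG aTag rX ;; Load rA aAtm rX ;; Load rC aCls rX ;; Copy rY rX ;; Inc rY ;;
     Cond (Equal rG rTwo)
       (Load rF aPos rA ;; Store aNext rX rF ;; Store aPos rA rY ;; Load rF aMark rA)
       (Cond (Equal rG rOne) (Store aHead rC rY) Skip ;; Store aMark rA rY ;; Load rF aPos rA) ;;
     Cond (Unequal rF rZero)
       (Dec rF ;; Load rF aCls rF ;; Cond (Equal rF rC) (Store aTaut rC rOne) Skip) Skip"

text \<open>Clearing runs over occurrences, since a range of atoms could be far larger than the
  input.\<close>

definition clear_body :: com where
  "clear_body = Load rA aAtm rX ;; Store aVal rA rZero ;; Store aDer rA rZero"

definition assign_body :: com where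
  "assign_body = Load rA aTrA rX ;; Load rV aTrV rX ;; Store aVal rA rV"

definition reset_body :: com where
  "reset_body = Load rV aTaut rX ;; Store aSat rX rV ;; Store aOpen rX rZero ;; Store aCnt rX rZero"

definition scan_body :: com where
  "scan_body = Load rG aTag rX ;; Load rA aAtm rX ;; Load rC aCls rX ;; Load rV aVal rA ;; Load rF aCnt rC ;;
     Cond (Equal rV rZero) (Copy rY rX ;; Inc rY ;; Store aOpen rC rY) Skip ;;
     Cond (Equal rG rTwo)
       (Inc rF ;; Cond (Equal rV rTwo) (Store aSat rC rOne) Skip)
       (Cond (Equal rV rOne) (Store aSat rC rOne ;; Cond (Equal rG rThree) (Inc rF) Skip) Skip) ;;
     Store aCnt rC rF"

definition choose_body :: com where
  "choose_body = Load rV aSat rX ;; Cond (Equal rV rZero) (Copy rC rX ;; Inc rC) Skip"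

definition derive_com :: com where
  "derive_com = Cond (Unequal rF rZero)
     (Dec rF ;; Load rA aAtm rF ;; Load rV aDer rA ;;
      Cond (Equal rV rZero) (Store aDer rA rOne ;; Store aQue rTail rA ;; Inc rTail) Skip) Skip"

definition facts_body :: com where
  "facts_body = Load rV aCnt rX ;; Load rF aHead rX ;; Cond (Equal rV rZero) derive_com Skip"

text \<open>The loop over the queue and the inner loop over the occurrences of an atom are flattened
  into one loop with a constant-time body; \<open>rO\<close> is the position in the inner one, and 0
  means that it has ended.\<close>

definition propagate_body :: com where
  "propagate_body = Cond (Unequal rO rZero)
     (Dec rO ;; Load rC aCls rO ;; Load rO aNext rO ;; Load rV aCnt rC ;; Dec rV ;; Store aCnt rC rV ;;
      Load rF aHead rC ;; Cond (Equal rV rZero) derive_com Skip)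
     (Cond (Less rHead rTail) (Load rA aQue rHead ;; Inc rHead ;; Load rO aPos rA) (Const rW 0))"

definition propagate :: com where
  "propagate = Const rTail 0 ;; For rX rK facts_body ;;
     Const rHead 0 ;; Const rO 0 ;; Const rW 1 ;; While (Equal rW rOne) propagate_body"

definition check_body :: com where
  "check_body = Load rA aTrA rX ;; Load rV aTrV rX ;; Load rF aDer rA ;;
     Cond (Equal rV rOne) (Cond (Equal rF rZero) (Const rW 0) Skip) Skip"

definition print_body :: com where
  "print_body = Load rA aTrA rX ;; Load rV aTrV rX ;; Cond (Equal rV rOne) (Inc rA ;; Emit rA) Skip"

definition backtrack_body :: com where
  "backtrack_body = Cond (Equal rD rZero) (Const rW 0 ;; Const rGo 0)
     (Dec rD ;; Load rV aTrV rD ;;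
      Cond (Equal rV rOne) (Store aTrV rD rTwo ;; Inc rD ;; Const rW 0) Skip)"

definition backtrack_com :: com where
  "backtrack_com = Const rGo 1 ;; Const rW 1 ;; While (Equal rW rOne) backtrack_body"

definition leaf_com :: com where
  "leaf_com = propagate ;; Const rW 1 ;; For rX rD check_body ;;
     Cond (Equal rW rOne) (For rX rD print_body ;; Emit rZero) Skip"

definition branch_com :: com where
  "branch_com = Const rGo 1 ;; Dec rF ;; Load rA aAtm rF ;; Store aTrA rD rA ;; Store aTrV rD rOne ;; Inc rD"

definition evaluate :: com where
  "evaluate = For rX rL clear_body ;; For rX rD assign_body ;; For rX rK reset_body ;; For rX rL scan_body ;;
     Const rC 0 ;; For rX rK choose_body"

definition node :: com where
  "node = evaluate ;;
     Cond (Equal rC rZero) (leaf_com ;; backtrack_com)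
       (Dec rC ;; Load rF aOpen rC ;; Cond (Equal rF rZero) backtrack_com branch_com)"

definition enumerate_com :: com where
  "enumerate_com = parse ;; For rX rL index_body ;; Const rD 0 ;; Const rGo 1 ;; While (Equal rGo rOne) node"

section \<open>Reading the input\<close>

text \<open>A token is what one iteration of the parser reads: an occurrence, or \<open>None\<close>
  for the end of a clause.\<close>

fun enc_token :: "(nat \<times> nat) option \<Rightarrow> nat list" where
  "enc_token None = [0]"
| "enc_token (Some (g, a)) = [g, a]"

definition tokens :: "clause_rep list \<Rightarrow> (nat \<times> nat) option list" where
  "tokens R = concat (map (\<lambda>r. map Some (clause_occs r) @ [None]) R)"

primrec token_occs :: "nat \<Rightarrow> (nat \<times> nat) option list \<Rightarrow> (nat \<times> nat \<times> nat) list" where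
  "token_occs k [] = []"
| "token_occs k (u # us) = (case u of None \<Rightarrow> token_occs (Suc k) us
     | Some (g, a) \<Rightarrow> (g, a, k) # token_occs k us)"

lemma encode_tokens: "encode R = concat (map enc_token (tokens R))"
proof -
  have lit: "encode_literal l = enc_token (Some (case l of Pos a \<Rightarrow> (2, a) | Neg a \<Rightarrow> (3, a)))" for l
    by (cases l) auto
  have "encode_clause r = concat (map enc_token (map Some (clause_occs r) @ [None]))" for r
    by (simp add: encode_clause_def clause_occs_def comp_def lit[abs_def] split: option.split)
  then show ?thesis
    by (induction R) (simp_all add: encode_def tokens_def)
qed

lemma token_occs_append:
  "token_occs k (ts @ us) = token_occs k ts @ token_occs (k + count_list ts None) us"
  by (induction ts arbitrary: k) (auto split: option.split)

lemma token_occs_Some: "token_occs k (map Some xs) = map (\<lambda>(g, a). (g, a, k)) xs"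
  by (induction xs) auto

lemma token_occs_tokens: "token_occs k (tokens R) = occs k R"
proof (induction R arbitrary: k)
  case (Cons r R)
  have "count_list (map Some xs) None = 0" for xs :: "(nat \<times> nat) list"
    by (induction xs) auto
  then show ?case using Cons[of "Suc k"]
    by (simp add: tokens_def token_occs_append token_occs_Some)
qed (simp add: tokens_def)

lemma count_tokens: "count_list (tokens R) None = length R"
proof (induction R)
  case (Cons r R)
  have "count_list (map Some xs) None = 0" for xs :: "(nat \<times> nat) list"
    by (induction xs) auto
  then show ?case using Cons by (simp add: tokens_def)
qed (simp add: tokens_def)

text \<open>An atom may itself be 0, so a closing zero can be recognised only because it stands
  where a tag is expected.\<close>

lemma tokens_tag: "Some (g, a) \<in> set (tokens R) \<Longrightarrow> g \<noteq> 0"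
  by (auto simp: tokens_def split: if_splits dest!: clause_occs_tag)

lemma enc_token_not_Nil: "enc_token u \<noteq> []"
  by (cases u rule: enc_token.cases) auto

lemma length_encode: "length (encode R) = 2 * length (occs 0 R) + length R"
proof -
  have "length (encode_literal l) = 2" for l by (cases l) auto
  then have "length (concat (map encode_literal ls)) = 2 * length ls" for ls
    by (induction ls) auto
  then have "length (encode_clause r) = 2 * length (clause_occs r) + 1" for r
    by (auto simp: encode_clause_def clause_occs_def split: option.splits)
  then show ?thesis by (induction R) (auto simp: encode_def length_occs)
qed

section \<open>Parsing the input and indexing the occurrences\<close>

context search
begin

text \<open>Strictly above all loop ranges: \<open>ncls\<close> is at most \<open>nocc + 1\<close>
  and a valid trail has at most \<open>nocc\<close> entries. In counting loops the factor of
  \<open>width\<close> is the time of the body plus 3, sometimes rounded up.\<close>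

definition width :: nat where "width = nocc + 2"

lemma width_gt: "nocc < width" "ncls < width" "0 < width"
  using ncls_le by (simp_all add: width_def)

definition loaded :: "state \<Rightarrow> bool" where
  "loaded s \<longleftrightarrow> reg s rL = nocc \<and> reg s rK = ncls \<and>
     reg s rOne = 1 \<and> reg s rTwo = 2 \<and> reg s rThree = 3 \<and> reg s rZero = 0 \<and>
     (\<forall>l<nocc. arr s aTag l = tag l \<and> arr s aAtm l = atm l \<and> arr s aCls l = cls l)"

definition taut_below :: "nat \<Rightarrow> nat \<Rightarrow> bool" where
  "taut_below j k \<longleftrightarrow>
     (\<exists>l<j. \<exists>l'<j. cls l = k \<and> cls l' = k \<and> atm l = atm l' \<and> tag l = 2 \<and> tag l' \<noteq> 2)"

definition indexed :: "nat \<Rightarrow> state \<Rightarrow> bool" where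
  "indexed j s \<longleftrightarrow>
     (\<forall>a. arr s aPos a = last_such (\<lambda>l. tag l = 2 \<and> atm l = a) j) \<and>
     (\<forall>a. arr s aMark a = last_such (\<lambda>l. tag l \<noteq> 2 \<and> atm l = a) j) \<and>
     (\<forall>k. arr s aHead k = last_such (\<lambda>l. tag l = 1 \<and> cls l = k) j) \<and>
     (\<forall>l<j. tag l = 2 \<longrightarrow> arr s aNext l = last_such (\<lambda>i. tag i = 2 \<and> atm i = atm l) l) \<and>
     (\<forall>k. arr s aTaut k = (if taut_below j k then 1 else 0))"

text \<open>\<open>ts\<close> are the tokens already read, so the reading position is always a token
  boundary.\<close>

definition parsing :: "state \<Rightarrow> bool" where
  "parsing s \<longleftrightarrow> (\<exists>ts us. tokens R = ts @ us \<and>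
     reg s rY = length (concat (map enc_token ts)) \<and>
     reg s rN = length (encode R) \<and> (\<forall>i<length (encode R). arr s aIn i = encode R ! i) \<and>
     reg s rL = length (token_occs 0 ts) \<and> reg s rK = count_list ts None \<and>
     reg s rOne = 1 \<and> reg s rTwo = 2 \<and> reg s rThree = 3 \<and> reg s rZero = 0 \<and>
     (\<forall>l<length (token_occs 0 ts).
        (arr s aTag l, arr s aAtm l, arr s aCls l) = token_occs 0 ts ! l) \<and>
     (\<forall>a. arr s aPos a = 0 \<and> arr s aMark a = 0 \<and> arr s aHead a = 0 \<and> arr s aTaut a = 0) \<and>
     out s = [])"

lemma parsing_step:
  assumes "parsing s" "reg s rY < reg s rN"
  shows "parsing (result parse_body s) \<and> reg (result parse_body s) rN = reg s rN \<and>
    reg (result parse_body s) rY > reg s rY"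
proof -
  obtain ts us where p: "tokens R = ts @ us"
     "reg s rY = length (concat (map enc_token ts))"
     "reg s rN = length (encode R)" "\<And>i. i<length (encode R) \<Longrightarrow> arr s aIn i = encode R ! i"
     "reg s rL = length (token_occs 0 ts)" "reg s rK = count_list ts None"
     "reg s rOne = 1" "reg s rTwo = 2" "reg s rThree = 3" "reg s rZero = 0"
     "\<And>l. l<length (token_occs 0 ts) \<Longrightarrow>
        (arr s aTag l, arr s aAtm l, arr s aCls l) = token_occs 0 ts ! l"
     "\<And>a. arr s aPos a = 0 \<and> arr s aMark a = 0 \<and> arr s aHead a = 0 \<and> arr s aTaut a = 0"
     "out s = []"
    using assms(1) unfolding parsing_def by blast
  have E: "encode R = concat (map enc_token ts) @ concat (map enc_token us)"
    unfolding encode_tokens p(1) by simp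
  have "us \<noteq> []" using assms(2) p(2,3) E by auto
  then obtain u us' where us: "us = u # us'" by (cases us) auto
  have ts': "tokens R = (ts @ [u]) @ us'" using p(1) us by simp
  show ?thesis
  proof (cases u)
    case None
    have "arr s aIn (reg s rY) = 0" using p(2,4) E us None by (simp add: nth_append)
    then show ?thesis
      unfolding parsing_def using p ts' None
      by (intro conjI exI[of _ "ts @ [u]"] exI[of _ us'])
         (auto simp: parse_body_def token_occs_append)
  next
    case (Some ga)
    then obtain g a where u: "u = Some (g, a)" by (cases ga) auto
    have g: "g \<noteq> 0" using tokens_tag[of g a R] p(1) us u by auto
    have "arr s aIn (reg s rY) = g" "arr s aIn (Suc (reg s rY)) = a"
      using p(2,4) E us u by (simp_all add: nth_append)
    then show ?thesis
      unfolding parsing_def using p ts' u g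
      by (intro conjI exI[of _ "ts @ [u]"] exI[of _ us'])
         (auto simp: parse_body_def token_occs_append nth_append less_Suc_eq)
  qed
qed

lemma runs_parse:
  "runs parse (initial_state (encode R)) (40 * width) (\<lambda>s. loaded s \<and> indexed 0 s \<and> out s = [])"
  unfolding parse_def
proof (intro runs_Seq[where b = 1 and P = "\<lambda>s. s = result c s0" for c s0])
  let ?s = "result (Const rThree 3) (result (Const rTwo 2) (result (Const rOne 1) (initial_state (encode R))))"
  fix s1 s2 s3
  assume "s1 = result (Const rOne 1) (initial_state (encode R))" "s2 = result (Const rTwo 2) s1"
    "s3 = result (Const rThree 3) s2"
  then have s3: "s3 = ?s" by simp
  show "runs (While (Less rY rN) parse_body) s3 (40 * width - 3) (\<lambda>s. loaded s \<and> indexed 0 s \<and> out s = [])"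
  proof (rule runs_While[where I = "\<lambda>s. parsing s \<and> reg s rN = length (encode R)"
        and \<mu> = "\<lambda>s. reg s rN - reg s rY" and k = "max_time parse_body"])
    show "parsing s3 \<and> reg s3 rN = length (encode R)"
      unfolding s3 parsing_def
      by (intro conjI exI[of _ "[]"] exI[of _ "tokens R"]) (simp_all add: initial_state_def)
    show "runs parse_body s (max_time parse_body)
        (\<lambda>s'. (parsing s' \<and> reg s' rN = length (encode R)) \<and> reg s' rN - reg s' rY < reg s rN - reg s rY)"
      if "parsing s \<and> reg s rN = length (encode R)" "test_holds (Less rY rN) s" for s
      using that parsing_step[of s] by (intro runs_straight) (auto simp: parse_body_def)
    show "loaded s \<and> indexed 0 s \<and> out s = []"
      if I: "parsing s \<and> reg s rN = length (encode R)" and "\<not> test_holds (Less rY rN) s" for s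
    proof -
      obtain ts us where p: "tokens R = ts @ us"
        "reg s rY = length (concat (map enc_token ts))"
        "reg s rL = length (token_occs 0 ts)" "reg s rK = count_list ts None"
        "reg s rOne = 1" "reg s rTwo = 2" "reg s rThree = 3" "reg s rZero = 0"
        "\<And>l. l<length (token_occs 0 ts) \<Longrightarrow>
           (arr s aTag l, arr s aAtm l, arr s aCls l) = token_occs 0 ts ! l"
        "\<And>a. arr s aPos a = 0 \<and> arr s aMark a = 0 \<and> arr s aHead a = 0 \<and> arr s aTaut a = 0"
        "out s = []"
        using I unfolding parsing_def by blast
      have "length (encode R) \<le> length (concat (map enc_token ts))"
        using that p(2) by simp
      then have "concat (map enc_token us) = []" unfolding encode_tokens p(1) by simp
      then have "us = []" by (cases us) (simp_all add: enc_token_not_Nil)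
      then have "ts = tokens R" using p(1) by simp
      then have t: "token_occs 0 ts = occs 0 R" "count_list ts None = length R"
        by (simp_all add: token_occs_tokens count_tokens)
      have "arr s aTag l = tag l \<and> arr s aAtm l = atm l \<and> arr s aCls l = cls l" if "l < nocc" for l
        using p(9)[of l] that unfolding t by (cases "occs 0 R ! l") (simp add: nocc_def tag_def atm_def cls_def)
      then show ?thesis
        using p t by (simp add: loaded_def indexed_def taut_below_def nocc_def ncls_def)
    qed
    \<comment> \<open>Two cells for each occurrence and one for each of the at most
      \<open>nocc + 1\<close> clauses.\<close>
    have "length (encode R) \<le> 3 * nocc + 1"
      using ncls_le by (simp add: length_encode nocc_def ncls_def)
    then show "1 + (reg s3 rN - reg s3 rY) * (max_time parse_body + 1) \<le> 40 * width - 3"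
      by (simp add: s3 initial_state_def parse_body_def width_def)
  qed
qed (use width_gt(3) in \<open>auto intro!: runs_straight\<close>)

text \<open>
  Because clauses are stored consecutively, an atom occurs earlier in the current clause iff its last
  earlier occurrence lies in this clause; this detects tautologies in linear time.
\<close>

lemma mark_iff:
  assumes "j < nocc"
  shows "last_such Q j \<noteq> 0 \<and> cls (last_such Q j - Suc 0) = cls j \<longleftrightarrow> (\<exists>l<j. Q l \<and> cls l = cls j)"
proof (cases "last_such Q j")
  case 0
  then show ?thesis by (auto simp: last_such_0_iff)
next
  case (Suc i)
  note i = last_such_SucD[OF Suc]
  have "cls i = cls j" if "l < j" "Q l" "cls l = cls j" for l
  proof -
    have "l \<le> i" using i that by (meson not_le)
    then show ?thesis using cls_mono[of l i] cls_mono[of i j] i that(3) assms by simp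
  qed
  then show ?thesis using i Suc by auto
qed

lemma taut_below_Suc:
  "taut_below (Suc j) k \<longleftrightarrow> taut_below j k \<or>
     cls j = k \<and> (\<exists>l<j. ((tag l = 2) \<noteq> (tag j = 2) \<and> atm l = atm j) \<and> cls l = cls j)"
  unfolding taut_below_def less_Suc_eq by (auto; metis)

lemma index_step:
  assumes "j < nocc" "loaded s" "indexed j s" "reg s rX = j"
  shows "reg (result index_body s) rX = j \<and> loaded (result index_body s) \<and>
    indexed (Suc j) (result index_body s) \<and> out (result index_body s) = out s"
proof -
  have l: "arr s aTag j = tag j" "arr s aAtm j = atm j" "arr s aCls j = cls j"
    using assms by (simp_all add: loaded_def)
  have lt: "i < nocc" if "last_such Q j = Suc i" for Q i
    using last_such_SucD[OF that] assms(1) by simp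
  have lc: "last_such Q j \<noteq> 0 \<Longrightarrow> arr s aCls (last_such Q j - Suc 0) = cls (last_such Q j - Suc 0)" for Q
    using lt[of Q] assms(2) by (cases "last_such Q j") (auto simp: loaded_def)
  show ?thesis
  proof (cases "tag j = 2")
    case True
    let ?f = "last_such (\<lambda>l. tag l \<noteq> 2 \<and> atm l = atm j) j"
    have t: "taut_below (Suc j) k \<longleftrightarrow> taut_below j k \<or> cls j = k \<and> ?f \<noteq> 0 \<and> cls (?f - Suc 0) = cls j" for k
      unfolding mark_iff[OF assms(1)] taut_below_Suc using True by simp
    show ?thesis
      using assms True l lc unfolding indexed_def t
      by (auto simp: index_body_def loaded_def less_Suc_eq)
  next
    case False
    let ?f = "last_such (\<lambda>l. tag l = 2 \<and> atm l = atm j) j"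
    have t: "taut_below (Suc j) k \<longleftrightarrow> taut_below j k \<or> cls j = k \<and> ?f \<noteq> 0 \<and> cls (?f - Suc 0) = cls j" for k
      unfolding mark_iff[OF assms(1)] taut_below_Suc using False by simp
    show ?thesis
      using assms False l lc unfolding indexed_def t
      by (auto simp: index_body_def loaded_def less_Suc_eq)
  qed
qed

definition static :: "state \<Rightarrow> bool" where
  "static s \<longleftrightarrow> loaded s \<and> indexed nocc s"

lemma runs_index:
  assumes "loaded s" "indexed 0 s" "out s = []"
  shows "runs (For rX rL index_body) s (30 * width) (\<lambda>s. static s \<and> out s = [])"
proof (rule runs_For[where I = "\<lambda>j s. loaded s \<and> indexed j s \<and> out s = []" and n = nocc
      and z = width and b = "max_time index_body"])
  show "runs index_body s (max_time index_body)
      (\<lambda>s'. reg s' rX = j \<and> loaded s' \<and> indexed (Suc j) s' \<and> out s' = [])"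
    if "j < nocc" "loaded s \<and> indexed j s \<and> out s = []" "reg s rX = j" for j s
    using that index_step[of j s] by (intro runs_straight) (auto simp: index_body_def)
qed (use assms width_gt in \<open>auto simp: loaded_def indexed_def static_def index_body_def\<close>)

section \<open>Evaluating a partial assignment\<close>

definition base :: "trail \<Rightarrow> nat list \<Rightarrow> state \<Rightarrow> bool" where
  "base tr w s \<longleftrightarrow> static s \<and> out s = w \<and> reg s rD = length tr \<and>
     (\<forall>i<length tr. arr s aTrA i = fst (rev tr ! i) \<and> arr s aTrV i = (if snd (rev tr ! i) then 1 else 2))"

text \<open>The numbering is chosen for these side conditions: data fixed after indexing live in
  registers up to 7 and arrays up to 9, the length and the entries of the trail in register 9 and in
  arrays 16 and 17.\<close>

lemma static_frame [simp]:
  "7 < x \<Longrightarrow> static (set_reg x v s) = static s"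
  "9 < a \<Longrightarrow> static (set_arr a i v s) = static s"
  "static (emit v s) = static s"
  by (simp_all add: static_def loaded_def indexed_def)

lemma base_frame [simp]:
  "7 < x \<Longrightarrow> x \<noteq> 9 \<Longrightarrow> base tr w (set_reg x v s) = base tr w s"
  "9 < a \<Longrightarrow> a < 16 \<Longrightarrow> base tr w (set_arr a i v s) = base tr w s"
  by (simp_all add: base_def)

lemma staticD:
  assumes "static s"
  shows "reg s 2 = nocc" "reg s 3 = ncls" "reg s 4 = 1" "reg s 5 = 2" "reg s 6 = 3" "reg s 7 = 0"
    "l < nocc \<Longrightarrow> arr s 2 l = tag l" "l < nocc \<Longrightarrow> arr s 3 l = atm l" "l < nocc \<Longrightarrow> arr s 4 l = cls l"
    "arr s 5 a = last_such (\<lambda>l. tag l = 2 \<and> atm l = a) nocc"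
    "l < nocc \<Longrightarrow> tag l = 2 \<Longrightarrow> arr s 6 l = last_such (\<lambda>i. tag i = 2 \<and> atm i = atm l) l"
    "arr s 8 k = last_such (\<lambda>l. tag l = 1 \<and> cls l = k) nocc"
    "arr s 9 k = (if taut k then 1 else 0)"
  using assms by (auto simp: static_def loaded_def indexed_def taut_def taut_below_def)

lemma baseD:
  assumes "base tr w s"
  shows "static s" "out s = w" "reg s 9 = length tr"
    "i < length tr \<Longrightarrow> arr s 16 i = fst (rev tr ! i)"
    "i < length tr \<Longrightarrow> arr s 17 i = (if snd (rev tr ! i) then 1 else 2)"
  using assms by (auto simp: base_def)

definition value_code :: "bool option \<Rightarrow> nat" where
  "value_code v = (case v of None \<Rightarrow> 0 | Some b \<Rightarrow> if b then 1 else 2)"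

lemma value_code_simps [simp]:
  "value_code None = 0" "value_code (Some b) = (if b then 1 else 2)"
  by (simp_all add: value_code_def)

text \<open>
  The number of obstacles to firing clause \<open>k\<close>: the positive body occurrences not in the set \<open>X\<close> of
  processed ones, and the negated atoms that are true, which delete the clause from the reduct.
\<close>

definition rest :: "trail \<Rightarrow> nat set \<Rightarrow> nat \<Rightarrow> nat \<Rightarrow> nat" where
  "rest tr X j k = card {l. l < j \<and> cls l = k \<and> (tag l = 2 \<and> l \<notin> X \<or> tag l = 3 \<and> atm l \<in> trues tr)}"

lemma rest_0: "rest tr X 0 k = 0"
  by (simp add: rest_def)

lemma rest_Suc:
  "rest tr {} (Suc j) k = rest tr {} j k +
     (if cls j = k \<and> (tag j = 2 \<or> tag j = 3 \<and> map_of tr (atm j) = Some True) then 1 else 0)"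
proof -
  have "{l. l < Suc j \<and> Q l} = {l. l < j \<and> Q l} \<union> (if Q j then {j} else {})" for Q
    by (auto simp: less_Suc_eq)
  then show ?thesis by (simp add: rest_def trues_def)
qed

lemma runs_clear:
  assumes "base tr w s"
  shows "runs (For rX rL clear_body) s (6 * width)
    (\<lambda>s. base tr w s \<and> (\<forall>l<nocc. arr s aVal (atm l) = 0 \<and> arr s aDer (atm l) = 0))"
proof (rule runs_For[where n = nocc and z = width and b = "max_time clear_body" and
      I = "\<lambda>j s. base tr w s \<and> (\<forall>l<j. arr s aVal (atm l) = 0 \<and> arr s aDer (atm l) = 0)"])
  fix j s
  assume j: "j < nocc" "reg s rX = j"
    and I: "base tr w s \<and> (\<forall>l<j. arr s aVal (atm l) = 0 \<and> arr s aDer (atm l) = 0)"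
  note b = staticD[OF baseD(1)[OF conjunct1[OF I]]]
  show "runs clear_body s (max_time clear_body) (\<lambda>s'. reg s' rX = j \<and> base tr w s' \<and>
      (\<forall>l<Suc j. arr s' aVal (atm l) = 0 \<and> arr s' aDer (atm l) = 0))"
    by (rule runs_straight) (use j I in \<open>simp_all add: clear_body_def b less_Suc_eq\<close>)
qed (use assms width_gt in \<open>auto simp: clear_body_def staticD baseD\<close>)

text \<open>The trail is replayed oldest entry first; after \<open>j\<close> steps the array holds
  the assignment of the \<open>j\<close> oldest entries, which as a trail is
  \<open>rev (take j (rev tr))\<close>.\<close>

lemma runs_assign:
  assumes "base tr w s" "valid tr" "\<forall>l<nocc. arr s aVal (atm l) = 0 \<and> arr s aDer (atm l) = 0"
  shows "runs (For rX rD assign_body) s (6 * width)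
    (\<lambda>s. base tr w s \<and> (\<forall>l<nocc. arr s aVal (atm l) = value_code (map_of tr (atm l)) \<and> arr s aDer (atm l) = 0))"
proof (rule runs_For[where n = "length tr" and z = width and b = "max_time assign_body" and
      I = "\<lambda>j s. base tr w s \<and> (\<forall>l<nocc.
        arr s aVal (atm l) = value_code (map_of (rev (take j (rev tr))) (atm l)) \<and> arr s aDer (atm l) = 0)"])
  fix j s
  assume j: "j < length tr" "reg s rX = j"
    and I: "base tr w s \<and> (\<forall>l<nocc.
        arr s aVal (atm l) = value_code (map_of (rev (take j (rev tr))) (atm l)) \<and> arr s aDer (atm l) = 0)"
  note b = staticD[OF baseD(1)[OF conjunct1[OF I]]] baseD[OF conjunct1[OF I]]
  have "take (Suc j) (rev tr) = take j (rev tr) @ [rev tr ! j]"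
    using j by (simp add: take_Suc_conv_app_nth)
  then have t: "map_of (rev (take (Suc j) (rev tr))) =
      (map_of (rev (take j (rev tr))))(fst (rev tr ! j) \<mapsto> snd (rev tr ! j))" by simp
  show "runs assign_body s (max_time assign_body) (\<lambda>s'. reg s' rX = j \<and> base tr w s' \<and>
      (\<forall>l<nocc. arr s' aVal (atm l) = value_code (map_of (rev (take (Suc j) (rev tr))) (atm l)) \<and>
         arr s' aDer (atm l) = 0))"
    unfolding t by (rule runs_straight) (use j I in \<open>simp_all add: assign_body_def b\<close>)
next
  have "length tr < width" using valid_length[OF assms(2)] natoms_le width_gt by linarith
  then show "length tr < width" .
qed (use assms in \<open>auto simp: assign_body_def staticD baseD\<close>)

lemma runs_reset:
  assumes "base tr w s" "\<forall>l<nocc. arr s aVal (atm l) = value_code (map_of tr (atm l)) \<and> arr s aDer (atm l) = 0"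
  shows "runs (For rX rK reset_body) s (7 * width)
    (\<lambda>s. base tr w s \<and>
      (\<forall>l<nocc. arr s aVal (atm l) = value_code (map_of tr (atm l)) \<and> arr s aDer (atm l) = 0) \<and>
      (\<forall>k<ncls. arr s aSat k = (if taut k then 1 else 0) \<and> arr s aOpen k = 0 \<and> arr s aCnt k = 0))"
proof (rule runs_For[where n = ncls and z = width and b = "max_time reset_body" and
      I = "\<lambda>j s. base tr w s \<and>
      (\<forall>l<nocc. arr s aVal (atm l) = value_code (map_of tr (atm l)) \<and> arr s aDer (atm l) = 0) \<and>
      (\<forall>k<j. arr s aSat k = (if taut k then 1 else 0) \<and> arr s aOpen k = 0 \<and> arr s aCnt k = 0)"])
  fix j s
  assume j: "j < ncls" "reg s rX = j" and I: "base tr w s \<and>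
      (\<forall>l<nocc. arr s aVal (atm l) = value_code (map_of tr (atm l)) \<and> arr s aDer (atm l) = 0) \<and>
      (\<forall>k<j. arr s aSat k = (if taut k then 1 else 0) \<and> arr s aOpen k = 0 \<and> arr s aCnt k = 0)"
  note b = staticD[OF baseD(1)[OF conjunct1[OF I]]]
  show "runs reset_body s (max_time reset_body) (\<lambda>s'. reg s' rX = j \<and> base tr w s' \<and>
      (\<forall>l<nocc. arr s' aVal (atm l) = value_code (map_of tr (atm l)) \<and> arr s' aDer (atm l) = 0) \<and>
      (\<forall>k<Suc j. arr s' aSat k = (if taut k then 1 else 0) \<and> arr s' aOpen k = 0 \<and> arr s' aCnt k = 0))"
    by (rule runs_straight) (use j I in \<open>simp_all add: reset_body_def b less_Suc_eq\<close>)
qed (use assms width_gt in \<open>auto simp: reset_body_def staticD baseD\<close>)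

definition scanned :: "trail \<Rightarrow> nat list \<Rightarrow> nat \<Rightarrow> state \<Rightarrow> bool" where
  "scanned tr w j s \<longleftrightarrow> base tr w s \<and>
    (\<forall>l<nocc. arr s aVal (atm l) = value_code (map_of tr (atm l)) \<and> arr s aDer (atm l) = 0) \<and>
    (\<forall>k<ncls.
      arr s aSat k = (if taut k \<or> (\<exists>l<j. cls l = k \<and> map_of tr (atm l) = Some (tag l \<noteq> 2)) then 1 else 0) \<and>
      arr s aOpen k = last_such (\<lambda>l. cls l = k \<and> map_of tr (atm l) = None) j \<and>
      arr s aCnt k = rest tr {} j k)"

lemma scan_step:
  assumes "scanned tr w j s" "j < nocc" "reg s rX = j"
  shows "reg (result scan_body s) rX = j \<and> scanned tr w (Suc j) (result scan_body s)"
proof -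
  have B: "base tr w s" using assms(1) by (simp add: scanned_def)
  note b = staticD[OF baseD(1)[OF B]]
  have k: "cls j < ncls" using cls_less[OF assms(2)] .
  have v: "arr s aVal (atm j) = value_code (map_of tr (atm j))"
    using assms by (simp add: scanned_def)
  show ?thesis
    using tag_cases[OF assms(2)]
    by (cases "map_of tr (atm j)"; elim disjE)
       (use assms k v in \<open>auto simp: scanned_def scan_body_def b ex_less_Suc rest_Suc\<close>)
qed

lemma runs_scan:
  assumes "scanned tr w 0 s"
  shows "runs (For rX rL scan_body) s (20 * width) (scanned tr w nocc)"
proof (rule runs_For[where n = nocc and z = width and b = "max_time scan_body" and I = "scanned tr w"])
  show "runs scan_body s (max_time scan_body) (\<lambda>s'. reg s' rX = j \<and> scanned tr w (Suc j) s')"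
    if "j < nocc" "scanned tr w j s" "reg s rX = j" for j s
    using that scan_step[of tr w j s] by (intro runs_straight) (auto simp: scan_body_def)
qed (use assms width_gt in \<open>auto simp: scan_body_def scanned_def staticD baseD\<close>)

text \<open>The values in \<open>aVal\<close> are dropped here: the counters already reflect the
  true negated atoms, and later loops read truth values off the trail.\<close>

definition evaluated :: "trail \<Rightarrow> nat list \<Rightarrow> state \<Rightarrow> bool" where
  "evaluated tr w s \<longleftrightarrow> base tr w s \<and> (\<forall>l<nocc. arr s aDer (atm l) = 0) \<and>
    (\<forall>k<ncls. arr s aOpen k = open_occ tr k \<and> arr s aCnt k = rest tr {} nocc k)"

lemma runs_choose:
  assumes "scanned tr w nocc s" "reg s rC = 0"
  shows "runs (For rX rK choose_body) s (8 * width)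
    (\<lambda>s. evaluated tr w s \<and> reg s rC = open_clause tr)"
proof (rule runs_For[where n = ncls and z = width and b = "max_time choose_body" and
      I = "\<lambda>j s. scanned tr w nocc s \<and> reg s rC = last_such (\<lambda>k. \<not> satisfied tr k) j"])
  fix j s
  assume j: "j < ncls" "reg s rX = j"
    and I: "scanned tr w nocc s \<and> reg s rC = last_such (\<lambda>k. \<not> satisfied tr k) j"
  then have B: "base tr w s" by (simp add: scanned_def)
  note b = staticD[OF baseD(1)[OF B]]
  have "arr s aSat j = (if satisfied tr j then 1 else 0)"
    using I j by (simp add: scanned_def satisfied_def)
  then show "runs choose_body s (max_time choose_body) (\<lambda>s'. reg s' rX = j \<and>
      scanned tr w nocc s' \<and> reg s' rC = last_such (\<lambda>k. \<not> satisfied tr k) (Suc j))"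
    by (intro runs_straight) (use j I in \<open>simp_all add: choose_body_def b scanned_def\<close>)
qed (use assms width_gt in \<open>auto simp: choose_body_def scanned_def staticD baseD evaluated_def open_clause_def open_occ_def\<close>)

lemma runs_evaluate:
  assumes "base tr w s" "valid tr"
  shows "runs evaluate s (48 * width) (\<lambda>s. evaluated tr w s \<and> reg s rC = open_clause tr)"
  unfolding evaluate_def
proof (intro runs_Seq)
  show "runs (For rX rL clear_body) s (6 * width)
    (\<lambda>s. base tr w s \<and> (\<forall>l<nocc. arr s aVal (atm l) = 0 \<and> arr s aDer (atm l) = 0))"
    using runs_clear[OF assms(1)] .
  show "runs (For rX rD assign_body) s1 (6 * width)
    (\<lambda>s. base tr w s \<and> (\<forall>l<nocc. arr s aVal (atm l) = value_code (map_of tr (atm l)) \<and> arr s aDer (atm l) = 0))"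
    if "base tr w s1 \<and> (\<forall>l<nocc. arr s1 aVal (atm l) = 0 \<and> arr s1 aDer (atm l) = 0)" for s1
    using that runs_assign assms(2) by blast
  show "runs (For rX rK reset_body) s2 (7 * width) (scanned tr w 0)"
    if "base tr w s2 \<and> (\<forall>l<nocc. arr s2 aVal (atm l) = value_code (map_of tr (atm l)) \<and> arr s2 aDer (atm l) = 0)" for s2
    using that by (intro runs_mono[OF runs_reset]) (auto simp: scanned_def rest_0)
  show "runs (For rX rL scan_body) s3 (20 * width) (scanned tr w nocc)" if "scanned tr w 0 s3" for s3
    using runs_scan[OF that] .
  show "runs (Const rC 0) s4 1 (\<lambda>s. scanned tr w nocc s \<and> reg s rC = 0)" if "scanned tr w nocc s4" for s4
    using that by (intro runs_straight) (auto simp: scanned_def)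
  show "runs (For rX rK choose_body) s5 (8 * width) (\<lambda>s. evaluated tr w s \<and> reg s rC = open_clause tr)"
    if "scanned tr w nocc s5 \<and> reg s5 rC = 0" for s5
    using runs_choose that by blast
qed (use width_gt(3) in \<open>auto\<close>)

section \<open>Horn propagation\<close>

definition queue :: "nat list \<Rightarrow> state \<Rightarrow> bool" where
  "queue q s \<longleftrightarrow> distinct q \<and> set q \<subseteq> atm ` {..<nocc} \<and> reg s rTail = length q \<and>
     (\<forall>i<length q. arr s aQue i = q ! i) \<and>
     (\<forall>l<nocc. arr s aDer (atm l) = (if atm l \<in> set q then 1 else 0))"

lemma queue_length: "queue q s \<Longrightarrow> length q \<le> nocc"
  using card_mono[of "atm ` {..<nocc}" "set q"] card_image_le[of "{..<nocc}" atm]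
  by (auto simp: queue_def distinct_card)

text \<open>\<open>q\<close> lists all atoms derived so far, dequeued or not, and \<open>X\<close>
  the body occurrences already counted down. The condition on all models \<open>N\<close> is
  soundness: nothing outside the least model has been derived.\<close>

definition horn :: "trail \<Rightarrow> nat list \<Rightarrow> nat list \<Rightarrow> nat set \<Rightarrow> state \<Rightarrow> bool" where
  "horn tr w q X s \<longleftrightarrow> base tr w s \<and> queue q s \<and>
     (\<forall>N. is_model N (reduct P (trues tr)) \<longrightarrow> set q \<subseteq> N) \<and>
     (\<forall>k<ncls. arr s aCnt k = rest tr X nocc k) \<and>
     X \<subseteq> {l. l < nocc \<and> tag l = 2 \<and> atm l \<in> set q}"

lemma horn_static: "horn tr w q X s \<Longrightarrow> static s"
  by (simp add: horn_def base_def)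

text \<open>Vacuous for constraints, which have no occurrence with tag 1; so they derive
  nothing.\<close>

definition head_derived :: "nat \<Rightarrow> nat list \<Rightarrow> bool" where
  "head_derived k q \<longleftrightarrow> (\<forall>l<nocc. tag l = 1 \<and> cls l = k \<longrightarrow> atm l \<in> set q)"

lemma rest_0_iff:
  "rest tr X nocc k = 0 \<longleftrightarrow>
    (\<forall>l<nocc. cls l = k \<longrightarrow> (tag l = 2 \<longrightarrow> l \<in> X) \<and> (tag l = 3 \<longrightarrow> atm l \<notin> trues tr))"
  by (auto simp: rest_def)

lemma rest_insert:
  assumes "i < nocc" "tag i = 2" "i \<notin> X"
  shows "rest tr (insert i X) nocc k = rest tr X nocc k - (if cls i = k then 1 else 0)"
proof -
  let ?A = "{l. l < nocc \<and> cls l = k \<and> (tag l = 2 \<and> l \<notin> X \<or> tag l = 3 \<and> atm l \<in> trues tr)}"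
  have "{l. l < nocc \<and> cls l = k \<and> (tag l = 2 \<and> l \<notin> insert i X \<or> tag l = 3 \<and> atm l \<in> trues tr)}
      = (if cls i = k then ?A - {i} else ?A)"
    using assms by auto
  then show ?thesis using assms by (simp add: rest_def)
qed

text \<open>With counter 0 no negated atom of the clause is true, so it survives in the reduct, and
  all its positive body atoms lie in \<open>q\<close>, hence in every model of the reduct.\<close>

lemma fire:
  assumes "horn tr w q X s" "rest tr X nocc k = 0" "l < nocc" "tag l = 1" "cls l = k"
    and N: "is_model N (reduct P (trues tr))"
  shows "atm l \<in> N"
proof -
  have k: "k < ncls" using cls_less assms by blast
  have hd: "head (cl k) = Some (atm l)" using head_iff[OF k] assms by blast
  have "\<not> (\<exists>a\<in>trues tr. Neg a \<in> body (cl k))"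
  proof
    assume "\<exists>a\<in>trues tr. Neg a \<in> body (cl k)"
    then obtain a where "a \<in> trues tr" "Neg a \<in> body (cl k)" by blast
    moreover from this obtain l' where "l' < nocc" "tag l' = 3" "atm l' = a" "cls l' = k"
      using neg_iff[OF k] by blast
    ultimately show False using assms(2) by (auto simp: rest_0_iff)
  qed
  moreover have "cl k \<in> P" using P_eq k by blast
  ultimately have "Clause (head (cl k)) {l \<in> body (cl k). \<exists>a. l = Pos a} \<in> reduct P (trues tr)"
    using hd unfolding reduct_def by blast
  then have sat: "sat_clause N (Clause (head (cl k)) {l \<in> body (cl k). \<exists>a. l = Pos a})"
    using N by (simp add: is_model_def)
  have "a \<in> N" if "Pos a \<in> body (cl k)" for a
  proof -
    obtain l' where "l' < nocc" "tag l' = 2" "atm l' = a" "cls l' = k"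
      using pos_iff[OF k] \<open>Pos a \<in> body (cl k)\<close> by blast
    then have "a \<in> set q" using assms(1,2) unfolding rest_0_iff horn_def by auto
    then show "a \<in> N" using assms(1) N unfolding horn_def by blast
  qed
  then show ?thesis using sat hd by (auto simp: sat_clause_def)
qed

text \<open>\<open>q'\<close> is empty or consists of the head alone. A clause has only one head, so
  treating the stored tag-1 occurrence is enough.\<close>

lemma derive_step:
  assumes H: "horn tr w q X s" and k: "k < ncls" and F: "reg s rF = last_such (\<lambda>l. tag l = 1 \<and> cls l = k) nocc"
    and z: "rest tr X nocc k = 0"
  shows "\<exists>q'. horn tr w (q @ q') X (result derive_com s) \<and> head_derived k (q @ q') \<and>
    (\<forall>x. x \<notin> {rA, rF, rV, rTail} \<longrightarrow> reg (result derive_com s) x = reg s x)"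
proof (cases "reg s rF")
  case 0
  then have "head_derived k q" using F by (auto simp: head_derived_def last_such_0_iff)
  moreover have "reg s rZero = 0" using staticD(6)[OF horn_static[OF H]] .
  ultimately show ?thesis using 0 H by (intro exI[of _ "[]"]) (auto simp: derive_com_def)
next
  case (Suc l)
  then have l: "l < nocc" "tag l = 1" "cls l = k" using F last_such_SucD by auto
  have B: "base tr w s" using H by (simp add: horn_def)
  note b = staticD[OF baseD(1)[OF B]]
  have un: "atm l' = atm l" if "l' < nocc" "tag l' = 1" "cls l' = k" for l'
    using that l head_iff[OF k] by (metis option.inject)
  have der: "arr s aDer (atm l) = (if atm l \<in> set q then 1 else 0)"
    using H l by (simp add: horn_def queue_def)
  show ?thesis
  proof (cases "atm l \<in> set q")
    case True
    then have "head_derived k q" using un by (auto simp: head_derived_def)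
    then show ?thesis using True H Suc der l
      by (intro exI[of _ "[]"]) (auto simp: derive_com_def b horn_def queue_def)
  next
    case False
    have "head_derived k (q @ [atm l])" using un by (auto simp: head_derived_def)
    moreover have "horn tr w (q @ [atm l]) X (result derive_com s)"
      using False H Suc der l fire[OF H z l]
      by (auto simp: derive_com_def b horn_def queue_def nth_append less_Suc_eq)
    ultimately show ?thesis using False Suc der l
      by (intro exI[of _ "[atm l]"]) (auto simp: derive_com_def b)
  qed
qed

lemma facts_step:
  assumes "j < ncls" "reg s rX = j" "horn tr w q {} s" "\<forall>k<j. rest tr {} nocc k = 0 \<longrightarrow> head_derived k q"
  shows "reg (result facts_body s) rX = j \<and> (\<exists>q. horn tr w q {} (result facts_body s) \<and>
    (\<forall>k<Suc j. rest tr {} nocc k = 0 \<longrightarrow> head_derived k q))"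
proof -
  have B: "base tr w s" using assms by (simp add: horn_def)
  note b = staticD[OF baseD(1)[OF B]]
  define s1 where "s1 = result (Load rV aCnt rX ;; Load rF aHead rX) s"
  have H: "horn tr w q {} s1" using assms(3) by (simp add: s1_def horn_def queue_def)
  have v: "reg s1 rV = rest tr {} nocc j" "reg s1 rF = last_such (\<lambda>l. tag l = 1 \<and> cls l = j) nocc"
    "reg s1 rX = j" "reg s1 rZero = 0"
    using assms by (simp_all add: s1_def b horn_def)
  have r: "result facts_body s = (if reg s1 rV = 0 then result derive_com s1 else s1)"
    using v(4) by (simp add: facts_body_def s1_def)
  show ?thesis
  proof (cases "rest tr {} nocc j = 0")
    case True
    obtain q' where "horn tr w (q @ q') {} (result derive_com s1)" "head_derived j (q @ q')"
      "\<forall>x. x \<notin> {rA, rF, rV, rTail} \<longrightarrow> reg (result derive_com s1) x = reg s1 x"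
      using derive_step[OF H assms(1) v(2) True] by blast
    moreover have "head_derived k (q @ q')" if "head_derived k q" for k
      using that by (auto simp: head_derived_def)
    ultimately show ?thesis using r v True assms(4) by (auto simp: less_Suc_eq intro!: exI[of _ "q @ q'"])
  next
    case False
    then show ?thesis using r v H assms(4) by (auto simp: less_Suc_eq intro!: exI[of _ q])
  qed
qed

text \<open>The completeness half of propagation. Every occurrence of a dequeued atom is processed,
  except for the atom being walked: if \<open>rO = Suc i\<close>, its occurrences up to
  \<open>i\<close> are open and the later ones done. A clause whose counter is 0 has its head in the
  queue.\<close>

definition propagating :: "trail \<Rightarrow> nat list \<Rightarrow> nat list \<Rightarrow> nat set \<Rightarrow> state \<Rightarrow> bool" where
  "propagating tr w q X s \<longleftrightarrow> horn tr w q X s \<and>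
     (\<forall>k<ncls. rest tr X nocc k = 0 \<longrightarrow> head_derived k q) \<and>
     reg s rHead \<le> length q \<and> reg s rW \<le> 1 \<and>
     (\<forall>l\<in>X. atm l \<in> set (take (reg s rHead) q)) \<and>
     (\<forall>l<nocc. tag l = 2 \<and> atm l \<in> set (take (reg s rHead) q) \<and> l \<notin> X \<longrightarrow>
        (\<exists>i. reg s rO = Suc i \<and> l \<le> i \<and> atm l = atm i)) \<and>
     (\<forall>i. reg s rO = Suc i \<longrightarrow> i < nocc \<and> tag i = 2 \<and> atm i \<in> set (take (reg s rHead) q) \<and>
        (\<forall>l\<le>i. tag l = 2 \<and> atm l = atm i \<longrightarrow> l \<notin> X)) \<and>
     (reg s rW = 0 \<longrightarrow> reg s rO = 0 \<and> reg s rHead = length q)"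

text \<open>
  Every iteration processes an occurrence, dequeues an atom or stops, and each happens at most once
  per occurrence or atom; hence linear time.
\<close>

definition todo :: "nat set \<Rightarrow> state \<Rightarrow> nat" where
  "todo X s = (nocc - card X) + (nocc - reg s rHead) + reg s rW"

text \<open>Occurrence \<open>i\<close> joins \<open>X\<close>, which lowers only the counter of its
  own clause; if that reaches 0, the head is derived. The link in \<open>aNext\<close> then moves to
  the previous occurrence of the atom.\<close>

lemma propagate_occ:
  assumes I: "propagating tr w q X s" and o: "reg s rO = Suc i"
  shows "\<exists>q' X'. propagating tr w q' X' (result propagate_body s) \<and>
    todo X' (result propagate_body s) < todo X s"
proof -
  have H: "horn tr w q X s" using I by (simp add: propagating_def)
  have B: "base tr w s" using H by (simp add: horn_def)
  note b = staticD[OF baseD(1)[OF B]]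
  let ?h = "reg s rHead"
  have i: "i < nocc" "tag i = 2" "atm i \<in> set (take ?h q)" "i \<notin> X"
    "\<forall>l\<le>i. tag l = 2 \<and> atm l = atm i \<longrightarrow> l \<notin> X"
    using I o unfolding propagating_def by blast+
  let ?X = "insert i X" and ?k = "cls i"
  have k: "?k < ncls" using cls_less[OF i(1)] .
  define s1 where "s1 = result (Dec rO ;; Load rC aCls rO ;; Load rO aNext rO ;; Load rV aCnt rC ;;
    Dec rV ;; Store aCnt rC rV ;; Load rF aHead rC) s"
  have X: "?X \<subseteq> {l. l < nocc \<and> tag l = 2 \<and> atm l \<in> set q}"
    using H i by (auto simp: horn_def dest: in_set_takeD)
  have H1: "horn tr w q ?X s1"
    using H X o i k unfolding horn_def
    by (auto simp: s1_def b queue_def rest_insert)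
  have v: "reg s1 rV = rest tr ?X nocc ?k" "reg s1 rF = last_such (\<lambda>l. tag l = 1 \<and> cls l = ?k) nocc"
    "reg s1 rO = last_such (\<lambda>l. tag l = 2 \<and> atm l = atm i) i"
    "reg s1 rHead = ?h" "reg s1 rW = reg s rW" "reg s1 rZero = 0"
    using H o i k by (simp_all add: s1_def b horn_def rest_insert)
  have r: "result propagate_body s = (if reg s1 rV = 0 then result derive_com s1 else s1)"
    using v(6) o b by (simp add: propagate_body_def s1_def)
  have old: "rest tr ?X nocc k' = 0 \<longrightarrow> head_derived k' q" if "k' < ncls" "k' \<noteq> ?k" for k'
    using I that i by (simp add: propagating_def rest_insert)
  have "\<exists>q'. horn tr w (q @ q') ?X (result propagate_body s) \<and>
      (\<forall>k'<ncls. rest tr ?X nocc k' = 0 \<longrightarrow> head_derived k' (q @ q')) \<and>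
      (\<forall>x\<in>{rO, rHead, rW}. reg (result propagate_body s) x = reg s1 x)"
  proof (cases "rest tr ?X nocc ?k = 0")
    case True
    obtain q' where q': "horn tr w (q @ q') ?X (result derive_com s1)" "head_derived ?k (q @ q')"
      "\<forall>x. x \<notin> {rA, rF, rV, rTail} \<longrightarrow> reg (result derive_com s1) x = reg s1 x"
      using derive_step[OF H1 k v(2) True] by blast
    have "head_derived k' (q @ q')" if "k' < ncls" "rest tr ?X nocc k' = 0" for k'
      using old[OF that(1)] that(2) q'(2) by (cases "k' = ?k") (auto simp: head_derived_def)
    then show ?thesis using q' r v True by (intro exI[of _ q']) auto
  next
    case False
    have "rest tr ?X nocc k' = 0 \<longrightarrow> head_derived k' q" if "k' < ncls" for k'
      using old[OF that] False by (cases "k' = ?k") auto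
    then show ?thesis using H1 r v False by (intro exI[of _ "[]"]) auto
  qed
  then obtain q' where q': "horn tr w (q @ q') ?X (result propagate_body s)"
    "\<forall>k'<ncls. rest tr ?X nocc k' = 0 \<longrightarrow> head_derived k' (q @ q')"
    "reg (result propagate_body s) rO = last_such (\<lambda>l. tag l = 2 \<and> atm l = atm i) i"
    "reg (result propagate_body s) rHead = ?h" "reg (result propagate_body s) rW = reg s rW"
    using v by auto
  let ?Q = "\<lambda>l. tag l = 2 \<and> atm l = atm i"
  have h: "?h \<le> length q" "reg s rW \<le> 1" "reg s rW \<noteq> 0" using I o by (auto simp: propagating_def)
  have tk: "take ?h (q @ q') = take ?h q" using h by simp
  have A: "\<forall>l\<in>?X. atm l \<in> set (take ?h q)" using I i(3) by (simp add: propagating_def)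
  \<comment> \<open>An open occurrence other than \<open>i\<close> lies before \<open>i\<close>,
    hence at or before the last such one, to which the link points.\<close>
  have cover: "\<exists>i'. last_such ?Q i = Suc i' \<and> l \<le> i' \<and> atm l = atm i'"
    if l: "l < nocc" "tag l = 2" "atm l \<in> set (take ?h q)" "l \<notin> ?X" for l
  proof -
    have "\<exists>i. reg s rO = Suc i \<and> l \<le> i \<and> atm l = atm i"
      using I l unfolding propagating_def by blast
    then have l': "l < i" "atm l = atm i" using o l(4) by auto
    then obtain i' where i': "last_such ?Q i = Suc i'"
      using l(2) last_such_0_iff[of ?Q i] not0_implies_Suc by blast
    have "l \<le> i'" using last_such_SucD[OF i'] l' l(2) by (meson not_le)
    then show ?thesis using last_such_SucD[OF i'] l' i' by auto
  qed
  have front: "i' < nocc \<and> tag i' = 2 \<and> atm i' \<in> set (take ?h q) \<and>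
      (\<forall>l\<le>i'. tag l = 2 \<and> atm l = atm i' \<longrightarrow> l \<notin> ?X)" if "last_such ?Q i = Suc i'" for i'
    using last_such_SucD[OF that] i by auto
  have "propagating tr w (q @ q') ?X (result propagate_body s)"
    unfolding propagating_def q'(3,4,5) tk
    using q'(1,2) A cover front h by auto
  moreover have "card ?X = Suc (card X)" "card ?X \<le> nocc"
  proof -
    have "finite X" using H finite_subset[of X "{..<nocc}"] by (auto simp: horn_def)
    then show "card ?X = Suc (card X)" using i(4) by simp
    show "card ?X \<le> nocc" using X card_mono[of "{..<nocc}" ?X] by auto
  qed
  ultimately show ?thesis
    by (intro exI[of _ "q @ q'"] exI[of _ ?X]) (auto simp: todo_def q'(4,5))
qed

lemma propagate_next:
  assumes I: "propagating tr w q X s" and o: "reg s rO = 0" and w: "reg s rW = 1"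
  shows "propagating tr w q X (result propagate_body s) \<and> todo X (result propagate_body s) < todo X s"
proof -
  have H: "horn tr w q X s" using I by (simp add: propagating_def)
  have B: "base tr w s" using H by (simp add: horn_def)
  note b = staticD[OF baseD(1)[OF B]]
  let ?h = "reg s rHead"
  have tl: "reg s rTail = length q" using H by (simp add: horn_def queue_def)
  have h: "?h \<le> length q" using I by (simp add: propagating_def)
  show ?thesis
  proof (cases "?h < length q")
    case False
    then have r: "result propagate_body s = set_reg rW 0 s" and l: "?h = length q"
      using o h by (simp_all add: propagate_body_def b tl)
    have "horn tr w q X (set_reg rW 0 s)" using H by (simp add: horn_def queue_def)
    then show ?thesis
      using I o w l unfolding r propagating_def by (simp add: todo_def)
  next
    case True
    let ?a = "q ! ?h"
    let ?Q = "\<lambda>l. tag l = 2 \<and> atm l = ?a"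
    have q: "arr s aQue ?h = ?a" "distinct q" using H True by (simp_all add: horn_def queue_def)
    have tk: "take (Suc ?h) q = take ?h q @ [?a]" using True by (simp add: take_Suc_conv_app_nth)
    \<comment> \<open>The queue has no repetitions, so this atom was not dequeued before and none of
      its occurrences is in \<open>X\<close>.\<close>
    have new: "?a \<notin> set (take ?h q)"
      using q(2) True by (auto simp: in_set_conv_nth nth_eq_iff_index_eq)
    have A: "\<forall>l\<in>X. atm l \<in> set (take ?h q)" using I by (simp add: propagating_def)
    have none: "l \<in> X" if "l < nocc" "tag l = 2" "atm l \<in> set (take ?h q)" for l
      using I that o unfolding propagating_def by auto
    have cover: "\<exists>i. last_such ?Q nocc = Suc i \<and> l \<le> i \<and> atm l = atm i"
      if l: "l < nocc" "tag l = 2" "atm l = ?a" for l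
    proof -
      obtain i where i: "last_such ?Q nocc = Suc i"
        using l last_such_0_iff[of ?Q nocc] not0_implies_Suc by blast
      have "l \<le> i" using last_such_SucD[OF i] l by (meson not_le)
      then show ?thesis using last_such_SucD[OF i] l i by auto
    qed
    have front: "i < nocc \<and> tag i = 2 \<and> atm i = ?a \<and> (\<forall>l\<le>i. tag l = 2 \<and> atm l = ?a \<longrightarrow> l \<notin> X)"
      if "last_such ?Q nocc = Suc i" for i
      using last_such_SucD[OF that] A new by auto
    have r: "result propagate_body s = set_reg rO (last_such ?Q nocc) (set_reg rHead (Suc ?h) (set_reg rA ?a s))"
      using True o by (simp add: propagate_body_def b tl q(1))
    have "horn tr w q X (result propagate_body s)" using H by (simp add: r horn_def queue_def)
    moreover have "\<forall>l<nocc. tag l = 2 \<and> atm l \<in> set (take (Suc ?h) q) \<and> l \<notin> X \<longrightarrow>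
        (\<exists>i. last_such ?Q nocc = Suc i \<and> l \<le> i \<and> atm l = atm i)"
      unfolding tk using none cover by auto
    moreover have "\<forall>i. last_such ?Q nocc = Suc i \<longrightarrow> i < nocc \<and> tag i = 2 \<and>
        atm i \<in> set (take (Suc ?h) q) \<and> (\<forall>l\<le>i. tag l = 2 \<and> atm l = atm i \<longrightarrow> l \<notin> X)"
    proof (intro allI impI)
      fix i assume "last_such ?Q nocc = Suc i"
      note front[OF this]
      then show "i < nocc \<and> tag i = 2 \<and> atm i \<in> set (take (Suc ?h) q) \<and>
          (\<forall>l\<le>i. tag l = 2 \<and> atm l = atm i \<longrightarrow> l \<notin> X)"
        unfolding tk by simp
    qed
    moreover have "\<forall>l\<in>X. atm l \<in> set (take (Suc ?h) q)" unfolding tk using A by simp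
    moreover have "\<forall>k<ncls. rest tr X nocc k = 0 \<longrightarrow> head_derived k q"
      using I by (simp add: propagating_def)
    ultimately have "propagating tr w q X (result propagate_body s)"
      unfolding propagating_def using True w by (simp add: r)
    moreover have "length q \<le> nocc" using H queue_length by (auto simp: horn_def)
    ultimately show ?thesis using True by (simp add: r todo_def)
  qed
qed

text \<open>On termination all positive occurrences of derived atoms are in \<open>X\<close>. A
  reduct clause whose body holds in \<open>set q\<close> thus has counter 0 and a derived head, so
  \<open>set q\<close> is a model; leastness is the soundness part of \<open>horn\<close>.\<close>

lemma propagated_least:
  assumes I: "propagating tr w q X s" and w: "reg s rW = 0"
  shows "is_least_model (set q) (reduct P (trues tr))"
proof -
  have z: "reg s rO = 0" "reg s rHead = length q"
    using I w unfolding propagating_def by blast+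
  have closed: "l \<in> X" if l: "l < nocc" "tag l = 2" "atm l \<in> set q" for l
  proof (rule ccontr)
    assume "l \<notin> X"
    moreover have "atm l \<in> set (take (reg s rHead) q)" using l(3) z(2) by simp
    ultimately have "\<exists>i. reg s rO = Suc i \<and> l \<le> i \<and> atm l = atm i"
      using I l(1,2) unfolding propagating_def by blast
    then show False using z(1) by simp
  qed
  have "sat_clause (set q) r'" if "r' \<in> reduct P (trues tr)" for r'
  proof -
    obtain r where r: "r \<in> P" "r' = Clause (head r) {l \<in> body r. \<exists>a. l = Pos a}" "head r \<noteq> None"
      "\<not> (\<exists>a\<in>trues tr. Neg a \<in> body r)" using \<open>r' \<in> reduct P (trues tr)\<close> unfolding reduct_def by blast
    obtain k where k: "k < ncls" "r = cl k" using r(1) P_eq by auto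
    obtain p where p: "head (cl k) = Some p" using r(3) k by auto
    have "p \<in> set q" if sat: "\<forall>l\<in>body r'. sat_literal (set q) l"
    proof -
      have "rest tr X nocc k = 0" unfolding rest_0_iff
      proof (intro allI impI conjI)
        fix l assume l: "l < nocc" "cls l = k"
        show "l \<in> X" if "tag l = 2"
        proof -
          have "Pos (atm l) \<in> body r'" using pos_iff[OF k(1)] l that r(2) k(2) by auto
          then have "atm l \<in> set q" using sat by fastforce
          then show ?thesis using closed l that by blast
        qed
        show "atm l \<notin> trues tr" if "tag l = 3"
          using neg_iff[OF k(1)] l that r(4) k(2) by blast
      qed
      then have "head_derived k q" using I k(1) unfolding propagating_def by blast
      moreover obtain l where "l < nocc" "tag l = 1" "atm l = p" "cls l = k"
        using head_iff[OF k(1), of p] p by blast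
      ultimately show "p \<in> set q" unfolding head_derived_def by blast
    qed
    then show ?thesis using p k(2) r(2) by (auto simp: sat_clause_def)
  qed
  then show ?thesis
    using I unfolding is_least_model_def is_model_def propagating_def horn_def by blast
qed

definition derived :: "trail \<Rightarrow> nat list \<Rightarrow> nat set \<Rightarrow> state \<Rightarrow> bool" where
  "derived tr w D s \<longleftrightarrow> base tr w s \<and> is_least_model D (reduct P (trues tr)) \<and>
     (\<forall>l<nocc. arr s aDer (atm l) = (if atm l \<in> D then 1 else 0))"

lemma runs_propagate:
  assumes "evaluated tr w s"
  shows "runs propagate s (80 * width) (\<lambda>s. \<exists>D. derived tr w D s)"
proof -
  have 1: "runs (For rX rK facts_body) s1 (20 * width)
      (\<lambda>s. \<exists>q. horn tr w q {} s \<and> (\<forall>k<ncls. rest tr {} nocc k = 0 \<longrightarrow> head_derived k q))"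
    if "evaluated tr w s1 \<and> reg s1 rTail = 0" for s1
  proof (rule runs_For[where n = ncls and z = width and b = "max_time facts_body" and
        I = "\<lambda>j s. \<exists>q. horn tr w q {} s \<and> (\<forall>k<j. rest tr {} nocc k = 0 \<longrightarrow> head_derived k q)"])
    show "\<exists>q. horn tr w q {} s1 \<and> (\<forall>k<0. rest tr {} nocc k = 0 \<longrightarrow> head_derived k q)"
      using that by (intro exI[of _ "[]"]) (simp add: evaluated_def horn_def queue_def)
    fix j s
    assume "\<exists>q. horn tr w q {} s \<and> (\<forall>k<j. rest tr {} nocc k = 0 \<longrightarrow> head_derived k q)"
    then obtain q where q: "horn tr w q {} s" "\<forall>k<j. rest tr {} nocc k = 0 \<longrightarrow> head_derived k q"
      by blast
    show "\<exists>q. horn tr w q {} (set_reg rX v s) \<and> (\<forall>k<j. rest tr {} nocc k = 0 \<longrightarrow> head_derived k q)" for v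
      using q by (intro exI[of _ q]) (simp add: horn_def queue_def)
    show "reg s rK = ncls" using staticD(2)[OF horn_static[OF q(1)]] .
    show "runs facts_body s (max_time facts_body) (\<lambda>s'. reg s' rX = j \<and>
        (\<exists>q. horn tr w q {} s' \<and> (\<forall>k<Suc j. rest tr {} nocc k = 0 \<longrightarrow> head_derived k q)))"
      if "j < ncls" "reg s rX = j"
      using facts_step[OF that q] by (intro runs_straight) (simp_all add: facts_body_def derive_com_def)
  qed (use width_gt in \<open>auto simp: facts_body_def derive_com_def\<close>)
  have 2: "runs (While (Equal rW rOne) propagate_body) s2 (56 * width) (\<lambda>s. \<exists>D. derived tr w D s)"
    if "\<exists>q. propagating tr w q {} s2" "reg s2 rW = 1" "reg s2 rHead = 0" for s2
  proof (rule runs_While_variant[where k = "max_time propagate_body" and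
        I = "\<lambda>n s. \<exists>q X. propagating tr w q X s \<and> todo X s = n"])
    \<comment> \<open>Nothing is processed or dequeued yet, and \<open>rW = 1\<close> accounts for
      the stopping iteration.\<close>
    show "\<exists>q X. propagating tr w q X s2 \<and> todo X s2 = 2 * nocc + 1"
      using that by (force simp: todo_def)
    show "1 + (2 * nocc + 1) * (max_time propagate_body + 1) \<le> 56 * width"
      by (simp add: propagate_body_def derive_com_def width_def)
    fix n s assume "\<exists>q X. propagating tr w q X s \<and> todo X s = n"
    then obtain q X where I: "propagating tr w q X s" "todo X s = n" by blast
    have one: "reg s rOne = 1" using I staticD(3)[OF horn_static] by (auto simp: propagating_def)
    show "\<exists>D. derived tr w D s" if "\<not> test_holds (Equal rW rOne) s"
    proof -
      have "reg s rW = 0" using that one I by (auto simp: propagating_def)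
      then show ?thesis using propagated_least[OF I(1)] I(1)
        by (auto simp: derived_def propagating_def horn_def queue_def)
    qed
    show "runs propagate_body s (max_time propagate_body)
        (\<lambda>s'. \<exists>m<n. \<exists>q X. propagating tr w q X s' \<and> todo X s' = m)" if "test_holds (Equal rW rOne) s"
    proof -
      have "\<exists>q' X'. propagating tr w q' X' (result propagate_body s) \<and>
          todo X' (result propagate_body s) < todo X s"
      proof (cases "reg s rO")
        case 0
        then show ?thesis using propagate_next[OF I(1) 0] that one by auto
      next
        case (Suc i)
        then show ?thesis using propagate_occ[OF I(1)] by blast
      qed
      moreover have "straight propagate_body" by (simp add: propagate_body_def derive_com_def)
      ultimately show ?thesis
        using I(2) by (intro runs_straight[OF _ _ order_refl]) auto
    qed
  qed
  show ?thesis unfolding propagate_def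
  proof (intro runs_Seq)
    show "runs (Const rTail 0) s 1 (\<lambda>s. evaluated tr w s \<and> reg s rTail = 0)"
      using assms by (intro runs_straight) (auto simp: evaluated_def)
    show "runs (For rX rK facts_body) s1 (20 * width)
      (\<lambda>s. \<exists>q. horn tr w q {} s \<and> (\<forall>k<ncls. rest tr {} nocc k = 0 \<longrightarrow> head_derived k q))"
      if "evaluated tr w s1 \<and> reg s1 rTail = 0" for s1 using 1[OF that] .
    show "runs (Const rHead 0) s2 1 (\<lambda>s. \<exists>q. horn tr w q {} s \<and>
        (\<forall>k<ncls. rest tr {} nocc k = 0 \<longrightarrow> head_derived k q) \<and> reg s rHead = 0)"
      if "\<exists>q. horn tr w q {} s2 \<and> (\<forall>k<ncls. rest tr {} nocc k = 0 \<longrightarrow> head_derived k q)" for s2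
      using that by (intro runs_straight) (auto simp: horn_def queue_def)
    show "runs (Const rO 0) s3 1 (\<lambda>s. \<exists>q. horn tr w q {} s \<and>
        (\<forall>k<ncls. rest tr {} nocc k = 0 \<longrightarrow> head_derived k q) \<and> reg s rHead = 0 \<and> reg s rO = 0)"
      if "\<exists>q. horn tr w q {} s3 \<and>
        (\<forall>k<ncls. rest tr {} nocc k = 0 \<longrightarrow> head_derived k q) \<and> reg s3 rHead = 0" for s3
      using that by (intro runs_straight) (auto simp: horn_def queue_def)
    show "runs (Const rW 1) s4 1 (\<lambda>s. (\<exists>q. propagating tr w q {} s) \<and> reg s rW = 1 \<and> reg s rHead = 0)"
      if "\<exists>q. horn tr w q {} s4 \<and>
        (\<forall>k<ncls. rest tr {} nocc k = 0 \<longrightarrow> head_derived k q) \<and> reg s4 rHead = 0 \<and> reg s4 rO = 0" for s4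
      using that by (intro runs_straight) (auto simp: propagating_def horn_def queue_def)
    show "runs (While (Equal rW rOne) propagate_body) s5 (56 * width) (\<lambda>s. \<exists>D. derived tr w D s)"
      if "(\<exists>q. propagating tr w q {} s5) \<and> reg s5 rW = 1 \<and> reg s5 rHead = 0" for s5
      using 2 that by blast
  qed (use width_gt(3) in auto)
qed

section \<open>Running the search\<close>

lemma derived_frame [simp]:
  "7 < x \<Longrightarrow> x \<noteq> 9 \<Longrightarrow> derived tr w D (set_reg x v s) = derived tr w D s"
  by (simp add: derived_def)

text \<open>At a satisfied leaf the true atoms are a model of their own reduct, so \<open>D\<close>
  is contained in them and only the converse inclusion is to be tested; the constraints hold
  already.\<close>

lemma accepted_iff:
  assumes "open_clause tr = 0" "valid tr" "is_least_model D (reduct P (trues tr))"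
  shows "accepted tr \<longleftrightarrow> trues tr \<subseteq> D"
proof -
  have M: "is_model (trues tr) P" using leaf_model[OF assms(1)] .
  have D: "D \<subseteq> trues tr"
    using assms(3) model_of_reduct[OF M order_refl] by (simp add: is_least_model_def)
  show ?thesis
  proof
    assume "accepted tr"
    then have "is_least_model (trues tr) (reduct P (trues tr))"
      by (simp add: accepted_def stable_model_def)
    then show "trues tr \<subseteq> D" using assms(3) by (simp add: is_least_model_def)
  next
    assume "trues tr \<subseteq> D"
    then have "trues tr = D" using D by blast
    moreover have "is_model (trues tr) (constraints P)" using M by (simp add: is_model_def constraints_def)
    moreover have "trues tr \<subseteq> atoms P"
      using assms(2) by (force simp: trues_def valid_def dest: map_of_SomeD)
    ultimately show "accepted tr" using assms(1,3) by (simp add: accepted_def stable_model_def)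
  qed
qed

lemma trail_atom:
  assumes "valid tr" "i < length tr"
  shows "\<exists>l<nocc. fst (rev tr ! i) = atm l"
proof -
  have "rev tr ! i \<in> set tr" using assms(2) by (metis length_rev nth_mem set_rev)
  then show ?thesis using assms(1) unfolding valid_def atoms_eq by fastforce
qed

lemma trues_subset_iff:
  assumes "valid tr"
  shows "trues tr \<subseteq> D \<longleftrightarrow> (\<forall>i<length tr. snd (rev tr ! i) \<longrightarrow> fst (rev tr ! i) \<in> D)"
proof -
  have "trues tr = fst ` {x \<in> set (rev tr). snd x}"
    using set_true_list[OF assms] by (simp add: true_list_def)
  then have "trues tr \<subseteq> D \<longleftrightarrow> (\<forall>x\<in>set (rev tr). snd x \<longrightarrow> fst x \<in> D)" by auto
  also have "\<dots> \<longleftrightarrow> (\<forall>i<length tr. snd (rev tr ! i) \<longrightarrow> fst (rev tr ! i) \<in> D)"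
    unfolding all_set_conv_all_nth by simp
  finally show ?thesis .
qed

lemma length_less_width: "valid tr \<Longrightarrow> length tr < width"
  using valid_length natoms_le by (fastforce simp: width_def)

lemma runs_check:
  assumes "derived tr w D s" "valid tr" "open_clause tr = 0" "reg s rW = 1"
  shows "runs (For rX rD check_body) s (9 * width)
    (\<lambda>s. base tr w s \<and> reg s rW = (if accepted tr then 1 else 0))"
proof (rule runs_For[where n = "length tr" and z = width and b = "max_time check_body" and
      I = "\<lambda>j s. derived tr w D s \<and>
        reg s rW = (if \<forall>i<j. snd (rev tr ! i) \<longrightarrow> fst (rev tr ! i) \<in> D then 1 else 0)"])
  fix j s
  assume j: "j < length tr" "reg s rX = j" and I: "derived tr w D s \<and>
        reg s rW = (if \<forall>i<j. snd (rev tr ! i) \<longrightarrow> fst (rev tr ! i) \<in> D then 1 else 0)"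
  then have B: "base tr w s" by (simp add: derived_def)
  note b = staticD[OF baseD(1)[OF B]] baseD[OF B]
  have d: "arr s aDer (fst (rev tr ! j)) = (if fst (rev tr ! j) \<in> D then 1 else 0)"
    using trail_atom[OF assms(2) j(1)] I by (auto simp: derived_def)
  have a: "(\<forall>i<Suc j. Q i) \<longleftrightarrow> (\<forall>i<j. Q i) \<and> Q j" for Q by (auto simp: less_Suc_eq)
  show "runs check_body s (max_time check_body) (\<lambda>s'. reg s' rX = j \<and> derived tr w D s' \<and>
        reg s' rW = (if \<forall>i<Suc j. snd (rev tr ! i) \<longrightarrow> fst (rev tr ! i) \<in> D then 1 else 0))"
    unfolding a by (rule runs_straight) (use j I d in \<open>auto simp: check_body_def b\<close>)
next
  fix s assume I: "derived tr w D s \<and> reg s rW =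
    (if \<forall>i<length tr. snd (rev tr ! i) \<longrightarrow> fst (rev tr ! i) \<in> D then 1 else 0)"
  then have least: "is_least_model D (reduct P (trues tr))" by (simp add: derived_def)
  show "base tr w s \<and> reg s rW = (if accepted tr then 1 else 0)"
    unfolding accepted_iff[OF assms(3,2) least] trues_subset_iff[OF assms(2)]
    using I by (simp add: derived_def)
qed (use assms length_less_width in \<open>auto simp: check_body_def derived_def baseD\<close>)

lemma base_emit: "base tr w s \<Longrightarrow> base tr (w @ [v]) (emit v s)"
  by (simp add: base_def)

lemma runs_print:
  assumes "base tr w s" "valid tr"
  shows "runs (For rX rD print_body) s (8 * width) (\<lambda>s. base tr (w @ map Suc (true_list tr)) s)"
proof (rule runs_For[where n = "length tr" and z = width and b = "max_time print_body" and
      I = "\<lambda>j s. base tr (w @ map Suc (map fst (filter snd (take j (rev tr))))) s"])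
  fix j s
  assume j: "j < length tr" "reg s rX = j"
    and I: "base tr (w @ map Suc (map fst (filter snd (take j (rev tr))))) s"
  note b = staticD[OF baseD(1)[OF I]] baseD[OF I]
  have t: "take (Suc j) (rev tr) = take j (rev tr) @ [rev tr ! j]"
    using j by (simp add: take_Suc_conv_app_nth)
  show "runs print_body s (max_time print_body) (\<lambda>s'. reg s' rX = j \<and>
      base tr (w @ map Suc (map fst (filter snd (take (Suc j) (rev tr))))) s')"
    unfolding t
    by (rule runs_straight) (use j I in \<open>simp_all add: print_body_def b base_def\<close>)
qed (use assms length_less_width in \<open>auto simp: print_body_def baseD true_list_def\<close>)

lemma runs_leaf:
  assumes "evaluated tr w s" "valid tr" "open_clause tr = 0"
  shows "runs leaf_com s (100 * width) (base tr (w @ report tr))"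
  unfolding leaf_com_def
proof (intro runs_Seq)
  show "runs propagate s (80 * width) (\<lambda>s. \<exists>D. derived tr w D s)"
    using runs_propagate[OF assms(1)] .
  show "runs (Const rW 1) s1 1 (\<lambda>s. (\<exists>D. derived tr w D s) \<and> reg s rW = 1)" if "\<exists>D. derived tr w D s1" for s1
    using that by (intro runs_straight) auto
  show "runs (For rX rD check_body) s2 (9 * width)
    (\<lambda>s. base tr w s \<and> reg s rW = (if accepted tr then 1 else 0))"
    if "(\<exists>D. derived tr w D s2) \<and> reg s2 rW = 1" for s2
    using that runs_check assms(2,3) by blast
  show "runs (Cond (Equal rW rOne) (For rX rD print_body ;; Emit rZero) Skip) s3 (9 * width + 1)
      (base tr (w @ report tr))"
    if B: "base tr w s3 \<and> reg s3 rW = (if accepted tr then 1 else 0)" for s3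
  proof (rule runs_Cond[where k = "9 * width"])
    have one: "reg s3 rOne = 1" using B staticD(3) baseD(1) by blast
    show "runs (For rX rD print_body ;; Emit rZero) s3 (9 * width) (base tr (w @ report tr))"
      if test: "test_holds (Equal rW rOne) s3"
    proof (rule runs_Seq)
      have "reg s3 rW = 1" using one test by simp
      then have "accepted tr" using B by (cases "accepted tr") simp_all
      then have r: "w @ report tr = (w @ map Suc (true_list tr)) @ [0]" by (simp add: report_def)
      show "runs (For rX rD print_body) s3 (8 * width) (base tr (w @ map Suc (true_list tr)))"
        using runs_print[OF _ assms(2)] B by blast
      show "runs (Emit rZero) s4 1 (base tr (w @ report tr))" if b: "base tr (w @ map Suc (true_list tr)) s4" for s4
        unfolding r using base_emit[OF b, of 0] staticD(6)[OF baseD(1)[OF b]]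
        by (intro runs_straight) simp_all
    qed (use width_gt(3) in simp)
    show "runs Skip s3 (9 * width) (base tr (w @ report tr))" if "\<not> test_holds (Equal rW rOne) s3"
    proof -
      have "reg s3 rW \<noteq> 1" using one that by simp
      then have "\<not> accepted tr" using B by (cases "accepted tr") simp_all
      then show ?thesis using B width_gt(3) by (intro runs_straight) (simp_all add: report_def)
    qed
  qed simp
qed (use width_gt(3) in auto)

definition resumed :: "nat list \<Rightarrow> trail option \<Rightarrow> state \<Rightarrow> bool" where
  "resumed w tr s \<longleftrightarrow> (case tr of None \<Rightarrow> static s \<and> out s = w \<and> reg s rGo = 0
     | Some tr' \<Rightarrow> base tr' w s \<and> reg s rGo = 1)"

text \<open>While the loop runs, the current trail \<open>tr'\<close> has the same backtracking
  result as the original one and its length is the variant; once \<open>rW = 0\<close>, that result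
  has been reached.\<close>

lemma runs_backtrack:
  assumes "base tr w s" "valid tr"
  shows "runs backtrack_com s (12 * width) (resumed w (backtrack tr))"
  unfolding backtrack_com_def
proof (intro runs_Seq)
  show "runs (Const rGo 1) s 1 (\<lambda>s. base tr w s \<and> reg s rGo = 1)"
    using assms by (intro runs_straight) auto
  show "runs (Const rW 1) s1 1 (\<lambda>s. base tr w s \<and> reg s rGo = 1 \<and> reg s rW = 1)"
    if "base tr w s1 \<and> reg s1 rGo = 1" for s1
    using that by (intro runs_straight) auto
  show "runs (While (Equal rW rOne) backtrack_body) s2 (12 * width - 2) (resumed w (backtrack tr))"
    if "base tr w s2 \<and> reg s2 rGo = 1 \<and> reg s2 rW = 1" for s2
  proof (rule runs_While_variant[where k = "max_time backtrack_body" and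
        I = "\<lambda>n s. reg s rOne = 1 \<and> (reg s rW = 1 \<and> reg s rGo = 1 \<and>
          (\<exists>tr'. base tr' w s \<and> backtrack tr' = backtrack tr \<and> n = Suc (length tr')) \<or>
          reg s rW = 0 \<and> resumed w (backtrack tr) s)"])
    show "reg s2 rOne = 1 \<and> (reg s2 rW = 1 \<and> reg s2 rGo = 1 \<and>
          (\<exists>tr'. base tr' w s2 \<and> backtrack tr' = backtrack tr \<and> Suc (length tr) = Suc (length tr')) \<or>
          reg s2 rW = 0 \<and> resumed w (backtrack tr) s2)"
      using that staticD(3)[OF baseD(1)] by blast
    show "1 + Suc (length tr) * (max_time backtrack_body + 1) \<le> 12 * width - 2"
      using length_less_width[OF assms(2)] by (simp add: backtrack_body_def)
    fix n s
    assume I: "reg s rOne = 1 \<and> (reg s rW = 1 \<and> reg s rGo = 1 \<and>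
          (\<exists>tr'. base tr' w s \<and> backtrack tr' = backtrack tr \<and> n = Suc (length tr')) \<or>
          reg s rW = 0 \<and> resumed w (backtrack tr) s)"
    show "resumed w (backtrack tr) s" if "\<not> test_holds (Equal rW rOne) s"
      using that I by auto
    show "runs backtrack_body s (max_time backtrack_body) (\<lambda>s'. \<exists>m<n. reg s' rOne = 1 \<and>
          (reg s' rW = 1 \<and> reg s' rGo = 1 \<and>
          (\<exists>tr'. base tr' w s' \<and> backtrack tr' = backtrack tr \<and> m = Suc (length tr')) \<or>
          reg s' rW = 0 \<and> resumed w (backtrack tr) s'))" if test: "test_holds (Equal rW rOne) s"
    proof -
      obtain tr' where tr': "base tr' w s" "backtrack tr' = backtrack tr" "n = Suc (length tr')"
        "reg s rW = 1" "reg s rGo = 1"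
        using I test by auto
      note b = staticD[OF baseD(1)[OF tr'(1)]] baseD[OF tr'(1)]
      show ?thesis
      proof (cases tr')
        case Nil
        have "resumed w (backtrack tr) (result backtrack_body s)"
          using Nil tr'(2) b by (auto simp: backtrack_body_def resumed_def)
        then show ?thesis using Nil tr'(3) b
          by (intro runs_straight[OF _ _ order_refl] exI[of _ 0])
             (auto simp: backtrack_body_def)
      next
        case (Cons x tr'')
        obtain a c where x: "x = (a, c)" by (cases x)
        have top: "arr s aTrV (length tr'') = (if c then 1 else 2)"
          using b(18)[of "length tr''"] Cons x by (simp add: nth_append)
        have low: "arr s aTrA i = fst (rev tr'' ! i) \<and> arr s aTrV i = (if snd (rev tr'' ! i) then 1 else 2)"
          if "i < length tr''" for i
          using b(17,18)[of i] that Cons by (simp add: nth_append)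
        have atm': "arr s aTrA (length tr'') = a"
          using b(17)[of "length tr''"] Cons x by (simp add: nth_append)
        show ?thesis
        proof (cases c)
          case True
          have "base ((a, False) # tr'') w (result backtrack_body s)"
            using b top low atm' Cons True
            by (auto simp: backtrack_body_def base_def nth_append less_Suc_eq)
          then have "resumed w (backtrack tr) (result backtrack_body s)"
            using Cons x True tr'(2,5) b top by (auto simp: resumed_def backtrack_body_def simp flip: tr'(2))
          then show ?thesis using Cons x True tr'(3) b top
            by (intro runs_straight[OF _ _ order_refl] exI[of _ 0])
               (auto simp: backtrack_body_def)
        next
          case False
          \<comment> \<open>Removing an entry only lowers \<open>rD\<close>; stale cells above it do
            not matter, as \<open>base\<close> reads below the length of the trail only.\<close>
          have "base tr'' w (result backtrack_body s)"
            using b top low Cons False by (auto simp: backtrack_body_def base_def)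
          moreover have "backtrack tr'' = backtrack tr" using tr'(2) Cons x False by simp
          ultimately show ?thesis using Cons x False tr'(3-5) b top
            by (intro runs_straight[OF _ _ order_refl] exI[of _ "length tr'"])
               (auto simp: backtrack_body_def)
        qed
      qed
    qed
  qed
qed (use width_gt(3) in \<open>auto simp: width_def\<close>)

text \<open>The next node in preorder; dead ends and satisfied leaves alike backtrack.\<close>

definition successor :: "trail \<Rightarrow> trail option" where
  "successor tr = (case pick tr of Some a \<Rightarrow> Some ((a, True) # tr) | None \<Rightarrow> backtrack tr)"

lemma successor_valid: "valid tr \<Longrightarrow> successor tr = Some tr' \<Longrightarrow> valid tr'"
  by (auto simp: successor_def pick_valid backtrack_Some split: option.splits)

lemma remaining_successor:
  "valid tr \<Longrightarrow> remaining tr = tr # (case successor tr of None \<Rightarrow> [] | Some tr' \<Rightarrow> remaining tr')"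
  by (cases "pick tr") (simp_all add: successor_def remaining_leaf remaining_branch)

lemma runs_branch:
  assumes "base tr w s" "reg s rF = Suc l" "l < nocc"
  shows "runs branch_com s 6 (resumed w (Some ((atm l, True) # tr)))"
proof (rule runs_straight)
  note b = staticD[OF baseD(1)[OF assms(1)]] baseD[OF assms(1)]
  show "resumed w (Some ((atm l, True) # tr)) (result branch_com s)"
    using assms(2,3) by (auto simp: resumed_def branch_com_def base_def b nth_append less_Suc_eq)
qed (simp_all add: branch_com_def)

lemma runs_node:
  assumes "base tr w s" "valid tr"
  shows "runs node s (165 * width) (resumed (w @ report tr) (successor tr))"
  unfolding node_def
proof (rule runs_Seq[OF runs_evaluate[OF assms]])
  fix s1 assume s1: "evaluated tr w s1 \<and> reg s1 rC = open_clause tr"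
  then have B: "base tr w s1" by (simp add: evaluated_def)
  note b = staticD[OF baseD(1)[OF B]]
  show "runs (Cond (Equal rC rZero) (leaf_com ;; backtrack_com)
      (Dec rC ;; Load rF aOpen rC ;; Cond (Equal rF rZero) backtrack_com branch_com)) s1 (113 * width)
      (resumed (w @ report tr) (successor tr))"
  proof (rule runs_Cond[where k = "112 * width"])
    assume "test_holds (Equal rC rZero) s1"
    then have leaf: "open_clause tr = 0" using s1 b by simp
    then have "successor tr = backtrack tr" by (simp add: successor_def pick_def)
    with runs_Seq[OF runs_leaf[OF conjunct1[OF s1] assms(2) leaf] runs_backtrack[OF _ assms(2)]]
    show "runs (leaf_com ;; backtrack_com) s1 (112 * width) (resumed (w @ report tr) (successor tr))"
      by simp
  next
    assume "\<not> test_holds (Equal rC rZero) s1"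
    then have "open_clause tr \<noteq> 0" using s1 b by simp
    then obtain k where k: "open_clause tr = Suc k" by (cases "open_clause tr") auto
    then have "k < ncls" using last_such_SucD[of _ ncls k] unfolding open_clause_def by blast
    have rep0: "report tr = []" using k by (simp add: report_def accepted_def)
    show "runs (Dec rC ;; Load rF aOpen rC ;; Cond (Equal rF rZero) backtrack_com branch_com) s1
        (112 * width) (resumed (w @ report tr) (successor tr))"
    proof (intro runs_Seq)
      show "runs (Dec rC) s1 1 (\<lambda>s. evaluated tr w s \<and> reg s rC = k)"
        using s1 k by (intro runs_straight) (auto simp: evaluated_def)
      show "runs (Load rF aOpen rC) s2 1 (\<lambda>s. base tr w s \<and> reg s rF = open_occ tr k)"
        if "evaluated tr w s2 \<and> reg s2 rC = k" for s2
        using that \<open>k < ncls\<close> by (intro runs_straight) (auto simp: evaluated_def)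
      show "runs (Cond (Equal rF rZero) backtrack_com branch_com) s3 (12 * width + 1)
          (resumed (w @ report tr) (successor tr))"
        if s3: "base tr w s3 \<and> reg s3 rF = open_occ tr k" for s3
      proof (rule runs_Cond[where k = "12 * width"])
        have z: "reg s3 rZero = 0" using s3 staticD(6)[OF baseD(1)] by blast
        show "runs backtrack_com s3 (12 * width) (resumed (w @ report tr) (successor tr))"
          if "test_holds (Equal rF rZero) s3"
        proof -
          have "successor tr = backtrack tr" using that s3 z k by (simp add: successor_def pick_def)
          then show ?thesis using runs_backtrack s3 assms(2) rep0 by simp
        qed
        show "runs branch_com s3 (12 * width) (resumed (w @ report tr) (successor tr))"
          if "\<not> test_holds (Equal rF rZero) s3"
        proof -
          have "open_occ tr k \<noteq> 0" using that s3 z by simp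
          then obtain l where l: "open_occ tr k = Suc l" by (cases "open_occ tr k") auto
          then have "l < nocc" using last_such_SucD[of _ nocc l] unfolding open_occ_def by blast
          then have "runs branch_com s3 6 (resumed w (Some ((atm l, True) # tr)))"
            using runs_branch s3 l by simp
          moreover have "successor tr = Some ((atm l, True) # tr)"
            using k l by (simp add: successor_def pick_def)
          ultimately show ?thesis using rep0 width_gt(3) by (auto intro: runs_mono)
        qed
      qed simp
    qed (use width_gt(3) in auto)
  qed (use width_gt(3) in simp)
qed (use width_gt(3) in simp)

text \<open>\<open>vs\<close> are the nodes already treated, whose reports form the output, and the
  variant is the number of nodes remaining; each iteration moves one node across.\<close>

lemma runs_search:
  assumes "static s" "out s = []" "reg s rD = 0" "reg s rGo = 1"
  shows "runs (While (Equal rGo rOne) node) s (1 + length (visit natoms []) * (165 * width + 1))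
    (\<lambda>s. out s = concat (map report (visit natoms [])))"
proof (rule runs_While_variant[where k = "165 * width" and
      I = "\<lambda>n s. static s \<and> (reg s rGo = 1 \<and>
        (\<exists>tr vs. valid tr \<and> base tr (concat (map report vs)) s \<and>
          visit natoms [] = vs @ remaining tr \<and> n = length (remaining tr)) \<or>
        reg s rGo = 0 \<and> out s = concat (map report (visit natoms [])))"])
  show "static s \<and> (reg s rGo = 1 \<and>
        (\<exists>tr vs. valid tr \<and> base tr (concat (map report vs)) s \<and>
          visit natoms [] = vs @ remaining tr \<and> length (visit natoms []) = length (remaining tr)) \<or>
        reg s rGo = 0 \<and> out s = concat (map report (visit natoms [])))"
    using assms by (auto simp: base_def valid_Nil remaining_def intro!: exI[of _ "[]"])
  fix n s
  assume I: "static s \<and> (reg s rGo = 1 \<and>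
        (\<exists>tr vs. valid tr \<and> base tr (concat (map report vs)) s \<and>
          visit natoms [] = vs @ remaining tr \<and> n = length (remaining tr)) \<or>
        reg s rGo = 0 \<and> out s = concat (map report (visit natoms [])))"
  then have one: "reg s rOne = 1" using staticD(3) by blast
  show "out s = concat (map report (visit natoms []))" if "\<not> test_holds (Equal rGo rOne) s"
    using that one I by auto
  show "runs node s (165 * width) (\<lambda>s'. \<exists>m<n. static s' \<and> (reg s' rGo = 1 \<and>
        (\<exists>tr vs. valid tr \<and> base tr (concat (map report vs)) s' \<and>
          visit natoms [] = vs @ remaining tr \<and> m = length (remaining tr)) \<or>
        reg s' rGo = 0 \<and> out s' = concat (map report (visit natoms []))))"
    if test: "test_holds (Equal rGo rOne) s"
  proof -
    obtain tr vs where tr: "valid tr" "base tr (concat (map report vs)) s"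
      "visit natoms [] = vs @ remaining tr" "n = length (remaining tr)"
      using test one I by auto
    note r = remaining_successor[OF tr(1)]
    show ?thesis
    proof (rule runs_mono[OF runs_node[OF tr(2,1)] order_refl])
      fix s' assume s': "resumed (concat (map report vs) @ report tr) (successor tr) s'"
      show "\<exists>m<n. static s' \<and> (reg s' rGo = 1 \<and>
        (\<exists>tr vs. valid tr \<and> base tr (concat (map report vs)) s' \<and>
          visit natoms [] = vs @ remaining tr \<and> m = length (remaining tr)) \<or>
        reg s' rGo = 0 \<and> out s' = concat (map report (visit natoms [])))"
      proof (cases "successor tr")
        case None
        then show ?thesis using s' tr(3,4) r by (auto simp: resumed_def intro!: exI[of _ 0])
      next
        case (Some tr')
        then have "base tr' (concat (map report (vs @ [tr]))) s'" "reg s' rGo = 1"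
          using s' by (simp_all add: resumed_def)
        moreover have "visit natoms [] = (vs @ [tr]) @ remaining tr'" "n = Suc (length (remaining tr'))"
          using tr(3,4) r Some by simp_all
        moreover have "valid tr'" using successor_valid tr(1) Some by blast
        ultimately show ?thesis using baseD(1) by blast
      qed
    qed
  qed
qed simp

lemma visit_length_le: "real (length (visit natoms [])) \<le> tree_const t * alpha t ^ card (atoms P)"
  using visit_length[OF valid_Nil, of natoms] by (simp add: natoms_def)

lemma runs_enumerate:
  "runs enumerate_com (initial_state (encode R)) (72 * width + length (visit natoms []) * (165 * width + 1))
    (\<lambda>s. enumerates (out s) {M. stable_model P M})"
  unfolding enumerate_com_def
proof (intro runs_Seq)
  show "runs parse (initial_state (encode R)) (40 * width) (\<lambda>s. loaded s \<and> indexed 0 s \<and> out s = [])"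
    using runs_parse .
  show "runs (For rX rL index_body) s1 (30 * width) (\<lambda>s. static s \<and> out s = [])"
    if "loaded s1 \<and> indexed 0 s1 \<and> out s1 = []" for s1 using that runs_index by blast
  show "runs (Const rD 0) s2 1 (\<lambda>s. static s \<and> out s = [] \<and> reg s rD = 0)"
    if "static s2 \<and> out s2 = []" for s2 using that by (intro runs_straight) auto
  show "runs (Const rGo 1) s3 1 (\<lambda>s. static s \<and> out s = [] \<and> reg s rD = 0 \<and> reg s rGo = 1)"
    if "static s3 \<and> out s3 = [] \<and> reg s3 rD = 0" for s3 using that by (intro runs_straight) auto
  show "runs (While (Equal rGo rOne) node) s4 (1 + length (visit natoms []) * (165 * width + 1))
      (\<lambda>s. enumerates (out s) {M. stable_model P M})"
    if "static s4 \<and> out s4 = [] \<and> reg s4 rD = 0 \<and> reg s4 rGo = 1" for s4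
    using that by (intro runs_mono[OF runs_search order_refl]) (auto simp: visit_enumerates)
qed (use width_gt(3) in \<open>auto simp: width_def\<close>)

end

theorem theorem2:
  fixes t :: nat
  assumes "t \<ge> 2"
  shows "\<exists>(c :: com) (C :: real). \<forall>(P :: nat clause set) R.
    t_program t P \<and> represents R P \<longrightarrow>
      (\<exists>T s. exec c (initial_state (encode R)) T s \<and>
             enumerates (out s) {M. stable_model P M} \<and>
             real T \<le> C * real (max 1 (program_size P)) * alpha t ^ card (atoms P))"
\<comment> \<open>The same machine program serves every \<open>t\<close>; only the constant depends
  on \<open>t\<close>.\<close>
proof (rule exI[of _ enumerate_com], rule exI[of _ "714 * tree_const t"], intro allI impI)
  fix P :: "nat clause set" and R
  assume "t_program t P \<and> represents R P"
  then interpret search t P R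
    using assms by unfold_locales auto
  let ?N = "length (visit natoms [])" and ?m = "max 1 (program_size P)"
  obtain T s where T: "exec enumerate_com (initial_state (encode R)) T s"
    "T \<le> 72 * width + ?N * (165 * width + 1)" "enumerates (out s) {M. stable_model P M}"
    using runs_enumerate by (auto simp: runs_def)
  \<comment> \<open>The root is always visited, so the set-up cost can be charged to the
    nodes.\<close>
  have "?N \<ge> 1" using visit_unfold[OF valid_Nil, of natoms] by simp
  then have "72 * width \<le> ?N * (72 * width)" by simp
  with T(2) have "T \<le> ?N * (72 * width) + ?N * (165 * width + 1)" by linarith
  also have "\<dots> = ?N * (237 * width + 1)" by (simp add: algebra_simps)
  \<comment> \<open>Here \<open>width \<le> 3 * ?m\<close>, so
    \<open>237 * width + 1 \<le> 238 * width \<le> 714 * ?m\<close>.\<close>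
  also have "\<dots> \<le> ?N * (714 * ?m)"
    by (intro mult_le_mono2) (simp add: width_def nocc_eq)
  finally have "real T \<le> real ?N * (714 * real ?m)"
    by (metis of_nat_mono of_nat_mult of_nat_numeral)
  also have "\<dots> \<le> (tree_const t * alpha t ^ card (atoms P)) * (714 * real ?m)"
    by (intro mult_right_mono visit_length_le) simp
  finally have "real T \<le> (714 * tree_const t) * real ?m * alpha t ^ card (atoms P)"
    by (simp add: algebra_simps)
  then show "\<exists>T s. exec enumerate_com (initial_state (encode R)) T s \<and>
      enumerates (out s) {M. stable_model P M} \<and>
      real T \<le> (714 * tree_const t) * real ?m * alpha t ^ card (atoms P)"
    using T(1,3) by blast
qed

end
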